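(* Let $p\geq 2$ and let $G$ be a finite simple $\{pK_2, \mathrm{gem}\}$-free graph. Then $\chi(G)\leq f_p(\omega(G))$, where the functions $f_p:\mathbb{N}\to\mathbb{N}$ ($p\geq 2$) are defined by: $f_t(1)=1$ for all $t\geq 2$; $f_2(2)=3$; $f_2(m)=m$ for $m\geq 3$; $f_p(2)=2p-2$ for $p\geq 3$; and $f_p(m)=f_{p-1}(m)+2m-2$ for $p,m\geq 3$.
   Context: $\chi(G)$ is the chromatic number and $\omega(G)$ the clique number of $G$. $pK_2$ is the disjoint union of $p$ edges. The gem is the graph obtained from the path $P_4$ on four vertices by adding a vertex adjacent to all four of its vertices (i.e. $K_1+P_4$). A graph is $\mathcal{F}$-free if it has no induced subgraph isomorphic to a member of $\mathcal{F}$. *)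

theory Defs
  imports "Graph_Theory.Pair_Digraph" "Graph_Theory.Digraph_Isomorphism"
begin

text \<open>
  A finite simple graph is a \<^locale>\<open>pair_graph\<close>: a finite vertex set with a symmetric
  irreflexive relation on it, so that each edge $uv$ is the pair of arcs $(u,v)$, $(v,u)$.
\<close>

definition proper_colouring :: "'a pair_pre_digraph \<Rightarrow> nat \<Rightarrow> ('a \<Rightarrow> nat) \<Rightarrow> bool" where
  "proper_colouring G k c \<longleftrightarrow>
     c ` pverts G \<subseteq> {..<k} \<and> (\<forall>(u, v) \<in> parcs G. c u \<noteq> c v)"

definition chromatic_number :: "'a pair_pre_digraph \<Rightarrow> nat" where
  "chromatic_number G = (LEAST k. \<exists>c. proper_colouring G k c)"

definition clique :: "'a pair_pre_digraph \<Rightarrow> 'a set \<Rightarrow> bool" where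
  "clique G S \<longleftrightarrow> S \<subseteq> pverts G \<and> pairwise (\<lambda>u v. (u, v) \<in> parcs G) S"

definition clique_number :: "'a pair_pre_digraph \<Rightarrow> nat" where
  "clique_number G = Max (card ` {S. clique G S})"

definition family_free :: "'b pair_pre_digraph set \<Rightarrow> 'a pair_pre_digraph \<Rightarrow> bool" where
  "family_free \<F> G \<longleftrightarrow>
     \<not> (\<exists>F \<in> \<F>. \<exists>H. induced_subgraph H (with_proj G) \<and> digraph_iso H (with_proj F))"

definition pK2 :: "nat \<Rightarrow> nat pair_pre_digraph" where
  "pK2 p = \<lparr> pverts = {..<2 * p},
             parcs = (\<Union>i<p. {(2 * i, 2 * i + 1), (2 * i + 1, 2 * i)}) \<rparr>"

text \<open>The path is $0,1,2,3$; the vertex adjacent to all of it is $4$.\<close>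

definition gem :: "nat pair_pre_digraph" where
  "gem = (let E = {(0, 1), (1, 2), (2, 3), (4, 0), (4, 1), (4, 2), (4, 3)}
          in \<lparr> pverts = {..<5}, parcs = E \<union> E\<inverse> \<rparr>)"

text \<open>
  The functions $f_p$ are only meaningful for $p \ge 2$; below that the value is that of $f_2$.
  The value $0$ at $m = 0$ serves the graph without vertices, whose clique number is $0$.
\<close>

fun gem_bound :: "nat \<Rightarrow> nat \<Rightarrow> nat" where
  "gem_bound p m =
     (if m = 0 then 0
      else if m = 1 then 1
      else if p \<le> 2 then (if m = 2 then 3 else m)
      else if m = 2 then 2 * p - 2
      else gem_bound (p - 1) m + 2 * m - 2)"

declare gem_bound.simps [simp del]

lemma gem_bound_eqs:
  "gem_bound p 1 = 1"
  "gem_bound 2 2 = 3"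
  "m \<ge> 3 \<Longrightarrow> gem_bound 2 m = m"
  "p \<ge> 3 \<Longrightarrow> gem_bound p 2 = 2 * p - 2"
  "p \<ge> 3 \<Longrightarrow> m \<ge> 3 \<Longrightarrow> gem_bound p m = gem_bound (p - 1) m + 2 * m - 2"
  by (subst gem_bound.simps; simp)+

lemma pair_graph_pK2: "pair_graph (pK2 p)"
  by unfold_locales
    (auto simp: pK2_def with_proj_def symmetric_def arcs_ends_def arc_to_ends_def sym_def)

lemma pair_graph_gem: "pair_graph gem"
  by unfold_locales
    (auto simp: gem_def Let_def with_proj_def symmetric_def arcs_ends_def arc_to_ends_def sym_def)

end

theory Submission
  imports Defs
begin

text \<open>
  The bound is proved by induction on \<open>p\<close>. For an edge \<open>uv\<close>, the neighbourhoods of \<open>u\<close> and \<open>v\<close> are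
  $P_4$-free by gem-freeness, hence coloured with $\omega - 1$ colours each, and the
  remaining vertices contain no $(p-1)K_2$. The induction starts at two places.

  For \<open>p = 2\<close> and a maximum clique \<open>K\<close> with at least three vertices, each vertex is coloured by a
  non-neighbour in \<open>K\<close>; adjacent vertices share at most one non-neighbour in \<open>K\<close>, and
  gem-freeness makes such clashes rare enough to be avoided.

  For \<open>p = 3\<close> and $\omega = 2$, one colour has to be saved. The vertices that see neither end of an
  edge \<open>uv\<close> induce a bipartite graph or a blown-up five-cycle with isolated vertices. In the latter case
  the cyclic classes and the neighbours of \<open>v\<close> map to a five-cycle, so three colours suffice for them
  and the neighbours of \<open>u\<close> get the fourth. Extending this to the isolated vertices can only fail
  for all five rotations of the colouring if an induced $3K_2$ appears.
\<close>

section \<open>Colourings and graphs without an induced path on four vertices\<close>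

definition colourable :: "('a \<Rightarrow> 'a \<Rightarrow> bool) \<Rightarrow> 'a set \<Rightarrow> nat \<Rightarrow> bool" where
  "colourable E S k \<longleftrightarrow> (\<exists>c. c ` S \<subseteq> {..<k} \<and> (\<forall>x\<in>S. \<forall>y\<in>S. E x y \<longrightarrow> c x \<noteq> c y))"

definition cliques_le :: "('a \<Rightarrow> 'a \<Rightarrow> bool) \<Rightarrow> 'a set \<Rightarrow> nat \<Rightarrow> bool" where
  "cliques_le E S m \<longleftrightarrow> (\<forall>K. K \<subseteq> S \<longrightarrow> pairwise E K \<longrightarrow> card K \<le> m)"

text \<open>For a symmetric irreflexive \<open>E\<close> these edges and non-edges force the four
  vertices to be distinct, so the path is an induced P4.\<close>

definition is_path4 :: "('a \<Rightarrow> 'a \<Rightarrow> bool) \<Rightarrow> 'a \<Rightarrow> 'a \<Rightarrow> 'a \<Rightarrow> 'a \<Rightarrow> bool" where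
  "is_path4 E a b c d \<longleftrightarrow> E a b \<and> E b c \<and> E c d \<and> \<not> E a c \<and> \<not> E a d \<and> \<not> E b d"

definition path4_free :: "('a \<Rightarrow> 'a \<Rightarrow> bool) \<Rightarrow> 'a set \<Rightarrow> bool" where
  "path4_free E S \<longleftrightarrow> (\<forall>a\<in>S. \<forall>b\<in>S. \<forall>c\<in>S. \<forall>d\<in>S. \<not> is_path4 E a b c d)"

definition gem_free :: "('a \<Rightarrow> 'a \<Rightarrow> bool) \<Rightarrow> 'a set \<Rightarrow> bool" where
  "gem_free E S \<longleftrightarrow> (\<forall>e\<in>S. path4_free E {x \<in> S. E e x})"

text \<open>A vertex shared by edges \<open>i\<close> and \<open>j\<close> would turn one of them
  into a forbidden adjacency, so the edges are disjoint automatically. The case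
  \<open>E (g i) (f j)\<close> is covered by symmetry.\<close>

definition matching_free :: "('a \<Rightarrow> 'a \<Rightarrow> bool) \<Rightarrow> 'a set \<Rightarrow> nat \<Rightarrow> bool" where
  "matching_free E S p \<longleftrightarrow> \<not> (\<exists>f g. \<forall>i<p. f i \<in> S \<and> g i \<in> S \<and> E (f i) (g i) \<and>
     (\<forall>j<p. j \<noteq> i \<longrightarrow> \<not> E (f i) (f j) \<and> \<not> E (f i) (g j) \<and> \<not> E (g i) (g j)))"

lemma colourable_mono: "colourable E S k \<Longrightarrow> k \<le> l \<Longrightarrow> colourable E S l"
  unfolding colourable_def by (meson lessThan_subset_iff order_trans)

lemma colourable_subset: "colourable E S k \<Longrightarrow> T \<subseteq> S \<Longrightarrow> colourable E T k"
  unfolding colourable_def by (meson image_mono order_trans subsetD)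

lemma colourable_union:
  assumes "colourable E S k" "colourable E T l"
  shows "colourable E (S \<union> T) (k + l)"
proof -
  obtain c where c: "c ` S \<subseteq> {..<k}" "\<forall>x\<in>S. \<forall>y\<in>S. E x y \<longrightarrow> c x \<noteq> c y"
    using assms(1) unfolding colourable_def by (elim exE conjE)
  obtain d where d: "d ` T \<subseteq> {..<l}" "\<forall>x\<in>T. \<forall>y\<in>T. E x y \<longrightarrow> d x \<noteq> d y"
    using assms(2) unfolding colourable_def by (elim exE conjE)
  show ?thesis
    unfolding colourable_def
  proof (intro exI[of _ "\<lambda>x. if x \<in> S then c x else k + d x"] conjI ballI impI)
    show "(\<lambda>x. if x \<in> S then c x else k + d x) ` (S \<union> T) \<subseteq> {..<k + l}"
      using c(1) d(1) by (auto simp: image_subset_iff trans_less_add1)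
  next
    fix x y assume xy: "x \<in> S \<union> T" "y \<in> S \<union> T" "E x y"
    have "c z \<noteq> k + n" if "z \<in> S" for z n using c(1) that by fastforce
    then show "(if x \<in> S then c x else k + d x) \<noteq> (if y \<in> S then c y else k + d y)"
      using c(2) d(2) xy by (metis UnE add_left_cancel)
  qed
qed

lemma colourable_indep: "(\<And>x y. x \<in> S \<Longrightarrow> y \<in> S \<Longrightarrow> \<not> E x y) \<Longrightarrow> colourable E S 1"
  unfolding colourable_def by (rule exI[of _ "\<lambda>_. 0"]) auto

text \<open>Allows the vertices of a maximum clique to serve as colours later on.\<close>

lemma colourable_finite_palette:
  assumes "finite K" "\<And>x. x \<in> S \<Longrightarrow> c x \<in> K"
    and "\<And>x y. x \<in> S \<Longrightarrow> y \<in> S \<Longrightarrow> E x y \<Longrightarrow> c x \<noteq> c y"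
  shows "colourable E S (card K)"
proof -
  obtain h where h: "bij_betw h K {..<card K}"
    using ex_bij_betw_finite_nat[OF assms(1)] by (auto simp: atLeast0LessThan)
  show ?thesis
    unfolding colourable_def
    by (rule exI[of _ "h \<circ> c"]) (use h assms(2,3) in \<open>auto simp: bij_betw_def inj_on_eq_iff\<close>)
qed

lemma cliques_le_subset: "cliques_le E S m \<Longrightarrow> T \<subseteq> S \<Longrightarrow> cliques_le E T m"
  unfolding cliques_le_def by blast

lemma gem_free_subset: "gem_free E S \<Longrightarrow> T \<subseteq> S \<Longrightarrow> gem_free E T"
  unfolding gem_free_def path4_free_def by blast

section \<open>Perfection of graphs without an induced P4\<close>

locale adjacency =
  fixes E :: "'a \<Rightarrow> 'a \<Rightarrow> bool"
  assumes sym: "E x y \<Longrightarrow> E y x" and irrefl: "\<not> E x x"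
begin

text \<open>If \<open>K\<close> missed \<open>I\<close>, take \<open>s\<close> in \<open>I\<close>
  with most neighbours in \<open>K\<close>, a \<open>k\<close> in \<open>K\<close> that
  \<open>s\<close> misses, and a neighbour \<open>t\<close> of \<open>k\<close> in \<open>I\<close>.
  By the choice of \<open>s\<close>, some \<open>l\<close> in \<open>K\<close> is seen by
  \<open>s\<close> but not by \<open>t\<close>, and \<open>s\<close>, \<open>l\<close>,
  \<open>k\<close>, \<open>t\<close> is an induced P4.\<close>

lemma path4_free_meets:
  assumes "finite S" "path4_free E S" "I \<subseteq> S" "\<And>x y. x \<in> I \<Longrightarrow> y \<in> I \<Longrightarrow> \<not> E x y"
    and dom: "\<And>x. x \<in> S \<Longrightarrow> x \<notin> I \<Longrightarrow> \<exists>s\<in>I. E x s"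
    and K: "K \<subseteq> S" "pairwise E K" and Kmax: "\<And>x. x \<in> S \<Longrightarrow> \<forall>k\<in>K. E x k \<Longrightarrow> False" and "S \<noteq> {}"
  shows "K \<inter> I \<noteq> {}"
proof
  assume disj: "K \<inter> I = {}"
  have fin: "finite I" "finite K" using assms(1,3) K(1) finite_subset by auto
  have "I \<noteq> {}" using \<open>S \<noteq> {}\<close> dom by blast
  define N where "N s = {k \<in> K. E s k}" for s
  have "finite (N s)" for s unfolding N_def using fin by simp
  let ?M = "(\<lambda>s. card (N s)) ` I"
  have "Max ?M \<in> ?M" using fin \<open>I \<noteq> {}\<close> by (intro Max_in) auto
  then obtain s where s: "s \<in> I" "Max ?M = card (N s)" by auto
  have smax: "card (N t) \<le> card (N s)" if "t \<in> I" for t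
    using Max_ge[of ?M "card (N t)"] that fin s(2) by simp
  obtain k where k: "k \<in> K" "\<not> E s k" using Kmax[of s] s(1) assms(3) by blast
  obtain t where t: "t \<in> I" "E k t" using dom[of k] k(1) K(1) disj by blast
  have "k \<in> N t" "k \<notin> N s" using k t sym by (auto simp: N_def)
  moreover have "\<not> N s \<subset> N t"
    using smax[OF t(1)] psubset_card_mono[OF \<open>finite (N t)\<close>, of "N s"] by linarith
  ultimately obtain l where l: "l \<in> N s" "l \<notin> N t" by blast
  have "l \<noteq> k" "l \<in> K" "E s l" "\<not> E t l" using l k by (auto simp: N_def)
  then have "is_path4 E s l k t"
    using k t s(1) K(2) assms(4) sym by (auto simp: is_path4_def pairwise_def)
  then show False
    using assms(2,3) K(1) s(1) t(1) k(1) \<open>l \<in> K\<close> unfolding path4_free_def by blast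
qed

lemma ex_maximal_indep:
  assumes "finite S"
  obtains I where "I \<subseteq> S" "\<And>x y. x \<in> I \<Longrightarrow> y \<in> I \<Longrightarrow> \<not> E x y"
    "\<And>x. x \<in> S \<Longrightarrow> x \<notin> I \<Longrightarrow> \<exists>s\<in>I. E x s"
proof -
  define P where "P I \<longleftrightarrow> I \<subseteq> S \<and> (\<forall>x\<in>I. \<forall>y\<in>I. \<not> E x y)" for I
  have "finite {I. P I}" using assms by (auto simp: P_def intro: finite_subset[of _ "Pow S"])
  moreover have "P {}" by (simp add: P_def)
  ultimately obtain I where I: "P I" "\<And>J. P J \<Longrightarrow> I \<subseteq> J \<Longrightarrow> J = I"
    using finite_has_maximal[of "{I. P I}"] by auto
  show thesis
  proof (rule that[of I])
    show "\<exists>s\<in>I. E x s" if "x \<in> S" "x \<notin> I" for x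
    proof (rule ccontr)
      assume "\<not> ?thesis"
      then have "P (insert x I)" using I(1) that irrefl sym unfolding P_def by blast
      then show False using I(2)[of "insert x I"] that by blast
    qed
  qed (use I(1) in \<open>auto simp: P_def\<close>)
qed

text \<open>A maximal independent set meets every maximal clique, so removing it costs one colour
  and lowers the clique bound by one.\<close>

lemma path4_free_colourable:
  assumes "finite S" "path4_free E S" "cliques_le E S m"
  shows "colourable E S m"
  using assms
proof (induction m arbitrary: S)
  case 0
  have "S = {}"
  proof (rule ccontr)
    assume "S \<noteq> {}"
    then obtain x where "x \<in> S" by blast
    then show False using 0(3)[unfolded cliques_le_def, rule_format, of "{x}"] by simp
  qed
  then show ?case by (simp add: colourable_def)
next
  case (Suc m)
  obtain I where I: "I \<subseteq> S" "\<And>x y. x \<in> I \<Longrightarrow> y \<in> I \<Longrightarrow> \<not> E x y"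
    "\<And>x. x \<in> S \<Longrightarrow> x \<notin> I \<Longrightarrow> \<exists>s\<in>I. E x s"
    using ex_maximal_indep[OF Suc.prems(1)] by blast
  have "cliques_le E (S - I) m"
    unfolding cliques_le_def
  proof (intro allI impI)
    fix K assume K: "K \<subseteq> S - I" "pairwise E K"
    show "card K \<le> m"
    proof (rule ccontr)
      assume big: "\<not> card K \<le> m"
      have finK: "finite K" using K(1) Suc.prems(1) finite_subset by blast
      \<comment> \<open>A clique with more than \<open>m\<close> vertices already attains the bound
        \<open>Suc m\<close>, hence is maximal in \<open>S\<close>.\<close>
      have "False" if "x \<in> S" "\<forall>k\<in>K. E x k" for x
      proof -
        have "x \<notin> K" using that irrefl by blast
        moreover have "pairwise E (insert x K)" using K(2) that sym by (auto simp: pairwise_insert)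
        ultimately show False
          using Suc.prems(3)[unfolded cliques_le_def, rule_format, of "insert x K"] K(1) that(1) big finK
          by auto
      qed
      moreover have "S \<noteq> {}" using big K(1) by auto
      ultimately have "K \<inter> I \<noteq> {}"
        using path4_free_meets[OF Suc.prems(1,2) I] K by blast
      then show False using K(1) by blast
    qed
  qed
  moreover have "path4_free E (S - I)" using Suc.prems(2) by (auto simp: path4_free_def)
  ultimately have "colourable E (S - I) m" using Suc.IH Suc.prems(1) by blast
  then have "colourable E ((S - I) \<union> I) (m + 1)" by (intro colourable_union colourable_indep I(2))
  then show ?case using I(1) by (simp add: Un_absorb2)
qed

end

section \<open>Graphs without $2K_2$ and gem\<close>

locale two_K2_gem_free = adjacency +
  fixes S K :: "'a set"
  assumes finite: "finite S" and gem_free: "gem_free E S"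
    and two_K2_free: "\<lbrakk>a \<in> S; b \<in> S; c \<in> S; d \<in> S; E a b; E c d\<rbrakk> \<Longrightarrow> E a c \<or> E a d \<or> E b c \<or> E b d"
    and K_sub: "K \<subseteq> S" and K_clique: "pairwise E K"
    and K_max: "cliques_le E S (card K)" and K_card: "card K \<ge> 3"
begin

text \<open>For \<open>x\<close> in \<open>K\<close> this is the singleton of \<open>x\<close>, so
  in the colouring below the vertices of \<open>K\<close> colour themselves.\<close>

definition M :: "'a \<Rightarrow> 'a set" where
  "M x = {k \<in> K. \<not> E x k}"

lemma finite_K: "finite K"
  using finite K_sub finite_subset by blast

lemma finite_M: "finite (M x)"
  unfolding M_def using finite_K by simp

lemma no_gem:
  "\<lbrakk>e \<in> S; a \<in> S; b \<in> S; c \<in> S; d \<in> S; E e a; E e b; E e c; E e d; E a b; E b c; E c d\<rbrakk>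
   \<Longrightarrow> E a c \<or> E a d \<or> E b d"
  using gem_free unfolding gem_free_def path4_free_def is_path4_def by blast

lemma K_adj: "a \<in> K \<Longrightarrow> b \<in> K \<Longrightarrow> a \<noteq> b \<Longrightarrow> E a b"
  using K_clique by (auto simp: pairwise_def)

lemma M_ne:
  assumes "x \<in> S" shows "M x \<noteq> {}"
proof
  assume "M x = {}"
  then have all: "\<forall>k\<in>K. E x k" by (auto simp: M_def)
  then have "pairwise E (insert x K)" "x \<notin> K"
    using K_clique sym irrefl by (auto simp: pairwise_insert)
  then show False
    using K_max[unfolded cliques_le_def, rule_format, of "insert x K"] assms K_sub finite_K by auto
qed

text \<open>A second common non-neighbour \<open>c\<close> would give an edge \<open>cb\<close> of
  \<open>K\<close> with no edge to \<open>xy\<close>, an induced 2K2.\<close>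

lemma M_inter_unique:
  assumes "x \<in> S" "y \<in> S" "E x y" "b \<in> M x" "b \<in> M y"
  shows "M x \<inter> M y = {b}"
proof -
  have "c = b" if "c \<in> M x" "c \<in> M y" for c
  proof (rule ccontr)
    assume "c \<noteq> b"
    then have "E c b" using that assms by (intro K_adj) (auto simp: M_def)
    then show False
      using two_K2_free[of x y c b] that assms K_sub by (auto simp: M_def)
  qed
  then show ?thesis using assms by blast
qed

text \<open>Such a \<open>k\<close> would be the apex of a gem over the path \<open>x\<close>,
  \<open>y\<close>, \<open>a\<close>, \<open>b\<close>.\<close>

lemma no_common_neighbour:
  assumes "x \<in> S" "y \<in> S" "E x y" "b \<in> M x" "b \<in> M y" "a \<in> M x" "a \<noteq> b" "k \<in> K"
  shows "\<not> (E x k \<and> E y k)"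
proof
  assume k: "E x k \<and> E y k"
  have "E y a" using M_inter_unique[OF assms(1-5)] assms(6,7) by (auto simp: M_def)
  moreover have "E a b" "E k a" "E k b" "\<not> E x a" "\<not> E x b" "\<not> E y b"
    using assms k by (auto simp: M_def intro: K_adj)
  ultimately show False
    using no_gem[of k x y a b] assms k K_sub sym by (auto simp: M_def)
qed

text \<open>Exchanging \<open>b\<close> for \<open>x\<close> and \<open>y\<close> would enlarge the
  maximum clique.\<close>

lemma not_both_single:
  assumes "x \<in> S" "y \<in> S" "E x y" "M x = {b}" "M y = {b}"
  shows False
proof -
  have b: "b \<in> K" "\<not> E x b" "\<not> E y b" using assms(4,5) by (auto simp: M_def)
  have adj: "E x k" "E y k" if "k \<in> K - {b}" for k using assms(4,5) that by (auto simp: M_def)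
  then have xy: "x \<notin> K - {b}" "y \<notin> K - {b}" "x \<noteq> y" using irrefl assms(3) by auto
  have "pairwise E (insert x (insert y (K - {b})))"
    using K_clique adj assms(3) sym by (auto simp: pairwise_def)
  moreover have "card (insert x (insert y (K - {b}))) = card K + 1"
    using xy finite_K b(1) card_Suc_Diff1[OF finite_K b(1)] by simp
  ultimately show False
    using K_max[unfolded cliques_le_def, rule_format, of "insert x (insert y (K - {b}))"] assms(1,2) K_sub
    by auto
qed

text \<open>
  Every vertex \<open>x\<close> is given a colour \<open>k \<in> M x\<close>, i.e. one of a vertex of \<open>K\<close> that it does not see. Since adjacent
  vertices share at most one such colour, it suffices that in each edge with a shared colour one
  endpoint avoids its bad colours.
\<close>

definition bad :: "'a \<Rightarrow> 'a \<Rightarrow> bool" where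
  "bad x b \<longleftrightarrow> (\<exists>y\<in>S. E x y \<and> M x \<inter> M y = {b})"

text \<open>If every colour is bad, each \<open>b\<close> in \<open>K\<close> has a neighbour
  \<open>f b\<close> of \<open>z\<close> that misses only \<open>b\<close> in \<open>K\<close>. For
  non-adjacent \<open>f b\<close> and \<open>f c\<close>, a third vertex \<open>d\<close> of
  \<open>K\<close> is the apex of a gem over \<open>f b\<close>, \<open>c\<close>, \<open>b\<close>,
  \<open>f c\<close>. Hence the \<open>f b\<close> and \<open>z\<close> form a clique larger than
  \<open>K\<close>.\<close>

lemma isolated_safe:
  assumes "z \<in> S" "M z = K"
  shows "\<exists>b\<in>K. \<not> bad z b"
proof (rule ccontr)
  assume "\<not> ?thesis"
  moreover have "K \<inter> M y = M y" for y by (auto simp: M_def)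
  ultimately have "\<forall>b\<in>K. \<exists>y\<in>S. E z y \<and> M y = {b}"
    using assms(2) by (simp add: bad_def)
  then obtain f where f: "\<And>b. b \<in> K \<Longrightarrow> f b \<in> S \<and> E z (f b) \<and> M (f b) = {b}" by metis
  have adj: "E (f b) (f c)" if bc: "b \<in> K" "c \<in> K" "b \<noteq> c" for b c
  proof (rule ccontr)
    assume nE: "\<not> E (f b) (f c)"
    have "\<not> K \<subseteq> {b, c}"
      using K_card card_mono[of "{b, c}" K] bc(3) by auto
    then obtain d where d: "d \<in> K" "d \<noteq> b" "d \<noteq> c" by blast
    have fadj: "E (f p) q \<longleftrightarrow> p \<noteq> q" if "p \<in> K" "q \<in> K" for p q
      using f[OF that(1)] that by (auto simp: M_def)
    have "E (f b) c" "E (f b) d" "E (f c) b" "E (f c) d" "\<not> E (f b) b" "\<not> E (f c) c"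
      using fadj bc d by simp_all
    moreover from this have "E d (f b)" "E d (f c)" "E b (f c)" "\<not> E c (f c)" using sym by blast+
    moreover have "E d c" "E d b" "E c b" using K_adj bc d by blast+
    moreover have "b \<in> S" "c \<in> S" "d \<in> S" "f b \<in> S" "f c \<in> S" using K_sub bc d f by blast+
    ultimately show False using no_gem[of d "f b" c b "f c"] nE by blast
  qed
  have "inj_on f K" using f by (metis inj_onI singleton_inject)
  moreover have "z \<notin> f ` K" using f irrefl by fastforce
  ultimately have "card (insert z (f ` K)) = card K + 1" using finite_K by (simp add: card_image)
  moreover have "pairwise E (insert z (f ` K))"
    using adj f sym by (auto simp: pairwise_def) 
  moreover have "insert z (f ` K) \<subseteq> S" using f assms(1) by auto
  ultimately show False
    using K_max unfolding cliques_le_def by (metis Suc_eq_plus1 not_less_eq_eq order_refl)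
qed

text \<open>Take three non-neighbours \<open>b\<close>, \<open>b'\<close>, \<open>d\<close> of
  \<open>x\<close> in \<open>K\<close> and suppose that \<open>y\<close> and \<open>y'\<close>
  witness that \<open>b\<close> and \<open>b'\<close> are bad. Neither sees the neighbour
  \<open>k\<close> of \<open>x\<close>. Then \<open>d\<close> is the apex of a gem, over
  \<open>y\<close>, \<open>y'\<close>, \<open>b\<close>, \<open>k\<close> if \<open>y\<close> and
  \<open>y'\<close> are adjacent and over \<open>y\<close>, \<open>b'\<close>, \<open>b\<close>,
  \<open>y'\<close> if not.\<close>

lemma large_safe:
  assumes "x \<in> S" "M x \<noteq> K" "card (M x) \<ge> 3"
  shows "\<exists>b\<in>M x. \<not> bad x b"
proof (rule ccontr)
  assume neg: "\<not> ?thesis"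
  obtain k where k: "k \<in> K" "E x k" using assms(2) by (auto simp: M_def)
  obtain b b' d where bd: "b \<in> M x" "b' \<in> M x" "d \<in> M x" "b \<noteq> b'" "d \<noteq> b" "d \<noteq> b'"
  proof -
    obtain b where b: "b \<in> M x" using M_ne assms(1) by blast
    have "\<not> M x \<subseteq> {b}" using assms(3) card_mono[of "{b}" "M x"] by auto
    then obtain b' where b': "b' \<in> M x" "b' \<noteq> b" by blast
    have "\<not> M x \<subseteq> {b, b'}" using assms(3) card_mono[of "{b, b'}" "M x"] b' by auto
    then show thesis using that b b' by blast
  qed
  obtain y where y: "y \<in> S" "E x y" "M x \<inter> M y = {b}" using neg bd unfolding bad_def by blast
  obtain y' where y': "y' \<in> S" "E x y'" "M x \<inter> M y' = {b'}" using neg bd unfolding bad_def by blast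
  have bK: "b \<in> K" "b' \<in> K" "d \<in> K" using bd by (auto simp: M_def)
  have nb: "\<not> E x b" "\<not> E x b'" "\<not> E x d" using bd by (auto simp: M_def)
  have mem: "c \<in> M y \<longleftrightarrow> c = b" "c \<in> M y' \<longleftrightarrow> c = b'" if "c \<in> M x" for c
    using that y(3) y'(3) by (metis IntI Int_iff singletonD singletonI)+
  then have My: "b \<in> M y" "b' \<notin> M y" "d \<notin> M y" "b' \<in> M y'" "b \<notin> M y'" "d \<notin> M y'"
    using bd by simp_all
  have ya: "\<not> E y b" "E y b'" "E y d" "\<not> E y' b'" "E y' b" "E y' d"
    using My bK by (auto simp: M_def)
  have yk: "\<not> E y k" "\<not> E y' k"
    using no_common_neighbour[OF assms(1) y(1,2) bd(1) My(1) bd(3,5) k(1)]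
      no_common_neighbour[OF assms(1) y'(1,2) bd(2) My(4) bd(3,6) k(1)] k(2) by blast+
  have S: "b \<in> S" "b' \<in> S" "d \<in> S" "k \<in> S" using bK k K_sub by auto
  have Kk: "E b b'" "E d b" "E d b'" "E b k" "E d k" using K_adj bK bd k nb by metis+
  show False
  proof (cases "E y y'")
    case True
    then show False
      using no_gem[of d y y' b k] S y(1) y'(1) ya yk Kk sym by blast
  next
    case False
    then show False
      using no_gem[of d y b' b y'] S y(1) y'(1) ya yk Kk sym by blast
  qed
qed

text \<open>A cyclic shift; it settles the clashes that remain for a clique of size three.\<close>

lemma ex_derangement:
  assumes "card K = 3"
  shows "\<exists>f. f ` K \<subseteq> K \<and> inj_on f K \<and> (\<forall>k\<in>K. f k \<noteq> k)"
proof -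
  obtain a b c where abc: "K = {a, b, c}" "a \<noteq> b" "b \<noteq> c" "a \<noteq> c"
    using assms unfolding card_3_iff by blast
  show ?thesis
    by (rule exI[of _ "\<lambda>k. if k = a then b else if k = b then c else a"]) (use abc in auto)
qed

text \<open>By \<open>no_common_neighbour\<close> the sets \<open>M x\<close> and \<open>M y\<close>
  cover \<open>K\<close>, so their sizes add up to \<open>card K + 1\<close>. If neither endpoint
  has a safe colour, both sizes are below 3, which leaves only sizes 2 and 2 with
  \<open>card K = 3\<close>.\<close>

lemma clash_safe:
  assumes "x \<in> S" "y \<in> S" "E x y" "M x \<inter> M y = {b}"
  shows "(\<exists>c\<in>M x. \<not> bad x c) \<or> (\<exists>c\<in>M y. \<not> bad y c) \<or>
    (card K = 3 \<and> (\<exists>i j. i \<in> K \<and> j \<in> K \<and> i \<noteq> j \<and> M x = K - {i} \<and> M y = K - {j}))"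
proof (cases "M x = K \<or> M y = K")
  case True
  then show ?thesis using isolated_safe assms(1,2) by blast
next
  case False
  have b: "b \<in> M x" "b \<in> M y" using assms(4) by auto
  have sub: "M x \<subseteq> K" "M y \<subseteq> K" by (auto simp: M_def)
  have "M x \<noteq> {b} \<or> M y \<noteq> {b}" using not_both_single assms by blast
  then have un: "M x \<union> M y = K"
  proof
    assume "M x \<noteq> {b}"
    then obtain a where "a \<in> M x" "a \<noteq> b" using b by blast
    then show ?thesis
      using no_common_neighbour[OF assms(1-3) b] sub by (auto simp: M_def)
  next
    assume "M y \<noteq> {b}"
    then obtain a where "a \<in> M y" "a \<noteq> b" using b by blast
    then show ?thesis
      using no_common_neighbour[OF assms(2,1) _ b(2,1)] sym[OF assms(3)] sub by (auto simp: M_def)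
  qed
  have c: "card (M x) + card (M y) = card K + 1"
    using card_Un_Int[OF finite_M finite_M, of x y] un assms(4) by simp
  have lt: "card (M x) < card K" "card (M y) < card K"
    using False sub psubset_card_mono[OF finite_K] by blast+
  show ?thesis
  proof (cases "card (M x) \<ge> 3 \<or> card (M y) \<ge> 3")
    case True
    then show ?thesis using large_safe assms(1,2) False by blast
  next
    case small: False
    then have K3: "card K = 3" using c K_card by linarith
    then have "card (K - M x) = 1" "card (K - M y) = 1"
      using small c lt sub finite_M by (auto simp: card_Diff_subset)
    then obtain i j where ij: "K - M x = {i}" "K - M y = {j}" by (auto simp: card_1_singleton_iff)
    then have "i \<noteq> j" using un by blast
    moreover have "M x = K - {i}" "M y = K - {j}" "i \<in> K" "j \<in> K" using ij sub by blast+
    ultimately show ?thesis using K3 by blast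
  qed
qed

lemma colourable: "colourable E S (card K)"
proof -
  obtain f where f: "card K = 3 \<Longrightarrow> f ` K \<subseteq> K \<and> inj_on f K \<and> (\<forall>k\<in>K. f k \<noteq> k)"
    using ex_derangement by blast
  \<comment> \<open>A safe colour is taken if there is one. Otherwise, when
    \<open>M x = K - {i}\<close> and \<open>K\<close> has three vertices, the colour is
    \<open>f i\<close>: it lies in \<open>M x\<close> because \<open>f\<close> has no fixed point,
    and it differs for different \<open>i\<close> because \<open>f\<close> is injective.\<close>
  define good where "good x c \<longleftrightarrow> c \<in> M x \<and> ((\<exists>b\<in>M x. \<not> bad x b) \<longrightarrow> \<not> bad x c) \<and>
    (\<forall>i\<in>K. (\<forall>b\<in>M x. bad x b) \<longrightarrow> card K = 3 \<longrightarrow> M x = K - {i} \<longrightarrow> c = f i)" for x c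
  have "\<exists>c. good x c" if "x \<in> S" for x
  proof (cases "(\<forall>b\<in>M x. bad x b) \<and> card K = 3 \<and> (\<exists>i\<in>K. M x = K - {i})")
    case True
    then obtain i where i: "i \<in> K" "M x = K - {i}" by blast
    then have "f i \<in> M x" using f True by blast
    moreover have "j = i" if "j \<in> K" "M x = K - {j}" for j using i that by blast
    ultimately have "good x (f i)" using True unfolding good_def by blast
    then show ?thesis ..
  next
    case False
    then show ?thesis using M_ne[OF that] unfolding good_def by blast
  qed
  then obtain c where c: "\<And>x. x \<in> S \<Longrightarrow> good x (c x)" by metis
  show ?thesis
  proof (rule colourable_finite_palette[OF finite_K])
    show "c x \<in> K" if "x \<in> S" for x using c[OF that] by (auto simp: good_def M_def)
  next
    fix x y assume xy: "x \<in> S" "y \<in> S" "E x y"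
    show "c x \<noteq> c y"
    proof
      assume eq: "c x = c y"
      have m: "c x \<in> M x" "c x \<in> M y" using c[OF xy(1)] c[OF xy(2)] eq by (auto simp: good_def)
      have I: "M x \<inter> M y = {c x}" using M_inter_unique[OF xy m] .
      then have "bad x (c x)" "bad y (c y)" using xy sym eq by (auto simp: bad_def)
      then have nosafe: "\<not> (\<exists>b\<in>M x. \<not> bad x b)" "\<not> (\<exists>b\<in>M y. \<not> bad y b)"
        using c[OF xy(1)] c[OF xy(2)] by (auto simp: good_def)
      then obtain i j where ij: "card K = 3" "i \<in> K" "j \<in> K" "i \<noteq> j" "M x = K - {i}" "M y = K - {j}"
        using clash_safe[OF xy I] by blast
      then have "c x = f i" "c y = f j"
        using c[OF xy(1)] c[OF xy(2)] nosafe unfolding good_def by blast+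
      then show False using eq f ij by (auto simp: inj_on_eq_iff)
    qed
  qed
qed

end

section \<open>Triangle-free graphs without $3K_2$\<close>

text \<open>
  In the hypothesis excluding three pairwise non-neighbouring edges the vertices need not be distinct:
  edges that share a vertex are joined by an edge.

  The vertices \<open>x0\<close>, \dots, \<open>x4\<close> are the obstacles to the five rotations of the colouring in
  \<open>four_colourable_if_good\<close> below: \<open>xi\<close> sees \<open>v\<close> and both cyclic neighbours of \<open>Ai\<close>.
\<close>

locale five_ring =
  fixes E :: "'a \<Rightarrow> 'a \<Rightarrow> bool" and u v and A0 A1 A2 A3 A4 :: "'a set" and x0 x1 x2 x3 x4
  assumes sym: "E x y \<Longrightarrow> E y x"
    and triangle_free: "E x y \<Longrightarrow> E y z \<Longrightarrow> \<not> E x z"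
    and three_K2_free: "E a b \<Longrightarrow> E c d \<Longrightarrow> E e f \<Longrightarrow>
      E a c \<or> E a d \<or> E b c \<or> E b d \<or> E a e \<or> E a f \<or> E b e \<or> E b f \<or> E c e \<or> E c f \<or> E d e \<or> E d f"
    and uv: "E u v"
    and ring: "a \<in> A0 \<Longrightarrow> b \<in> A1 \<Longrightarrow> E a b" "a \<in> A1 \<Longrightarrow> b \<in> A2 \<Longrightarrow> E a b"
      "a \<in> A2 \<Longrightarrow> b \<in> A3 \<Longrightarrow> E a b" "a \<in> A3 \<Longrightarrow> b \<in> A4 \<Longrightarrow> E a b" "a \<in> A4 \<Longrightarrow> b \<in> A0 \<Longrightarrow> E a b"
    and chords: "a \<in> A0 \<Longrightarrow> b \<in> A2 \<Longrightarrow> \<not> E a b" "a \<in> A1 \<Longrightarrow> b \<in> A3 \<Longrightarrow> \<not> E a b"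
      "a \<in> A2 \<Longrightarrow> b \<in> A4 \<Longrightarrow> \<not> E a b" "a \<in> A3 \<Longrightarrow> b \<in> A0 \<Longrightarrow> \<not> E a b" "a \<in> A4 \<Longrightarrow> b \<in> A1 \<Longrightarrow> \<not> E a b"
    and far: "a \<in> A0 \<union> A1 \<union> A2 \<union> A3 \<union> A4 \<Longrightarrow> \<not> E u a \<and> \<not> E v a"
    and v_x: "E v x0" "E v x1" "E v x2" "E v x3" "E v x4"
    and x_right: "\<exists>b\<in>A1. E x0 b" "\<exists>b\<in>A2. E x1 b" "\<exists>b\<in>A3. E x2 b" "\<exists>b\<in>A4. E x3 b" "\<exists>b\<in>A0. E x4 b"
    and x_left: "\<exists>b\<in>A4. E x0 b" "\<exists>b\<in>A0. E x1 b" "\<exists>b\<in>A1. E x2 b" "\<exists>b\<in>A2. E x3 b" "\<exists>b\<in>A3. E x4 b"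
begin

text \<open>Through this symmetry a fact proved at index 0 holds at all five indices, by
  interpreting the rotated locales.\<close>

lemma rotate: "five_ring E u v A1 A2 A3 A4 A0 x1 x2 x3 x4 x0"
proof
  show "a \<in> A1 \<union> A2 \<union> A3 \<union> A4 \<union> A0 \<Longrightarrow> \<not> E u a \<and> \<not> E v a" for a
    using far by blast
qed (fact sym triangle_free three_K2_free uv ring chords v_x x_right x_left)+

lemma x0_far: "a \<in> A0 \<union> A2 \<union> A3 \<Longrightarrow> \<not> E x0 a"
  using x_left(1) x_right(1) ring sym triangle_free by blast

lemma touch: "a \<in> A0 \<Longrightarrow> b \<in> A1 \<Longrightarrow> E y a \<Longrightarrow> \<not> E y b"
  using ring(1) triangle_free by blast

text \<open>Models the isolated vertices outside the blown-up cycle; they may still see neighbours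
  of \<open>u\<close> and of \<open>v\<close>.\<close>

definition hub :: "'a \<Rightarrow> bool" where
  "hub z \<longleftrightarrow> \<not> E u z \<and> \<not> E v z \<and> (\<forall>a \<in> A0 \<union> A1 \<union> A2 \<union> A3 \<union> A4. \<not> E z a)"

lemma x_far:
  "a \<in> A0 \<union> A2 \<union> A3 \<Longrightarrow> \<not> E x0 a" "a \<in> A1 \<union> A3 \<union> A4 \<Longrightarrow> \<not> E x1 a"
  "a \<in> A2 \<union> A4 \<union> A0 \<Longrightarrow> \<not> E x2 a" "a \<in> A3 \<union> A0 \<union> A1 \<Longrightarrow> \<not> E x3 a"
  "a \<in> A4 \<union> A1 \<union> A2 \<Longrightarrow> \<not> E x4 a"
proof -
  interpret r1: five_ring E u v A1 A2 A3 A4 A0 x1 x2 x3 x4 x0 by (rule rotate)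
  interpret r2: five_ring E u v A2 A3 A4 A0 A1 x2 x3 x4 x0 x1 by (rule r1.rotate)
  interpret r3: five_ring E u v A3 A4 A0 A1 A2 x3 x4 x0 x1 x2 by (rule r2.rotate)
  interpret r4: five_ring E u v A4 A0 A1 A2 A3 x4 x0 x1 x2 x3 by (rule r3.rotate)
  show  "a \<in> A0 \<union> A2 \<union> A3 \<Longrightarrow> \<not> E x0 a" "a \<in> A1 \<union> A3 \<union> A4 \<Longrightarrow> \<not> E x1 a"
  "a \<in> A2 \<union> A4 \<union> A0 \<Longrightarrow> \<not> E x2 a" "a \<in> A3 \<union> A0 \<union> A1 \<Longrightarrow> \<not> E x3 a"
  "a \<in> A4 \<union> A1 \<union> A2 \<Longrightarrow> \<not> E x4 a"
    by (fact x0_far r1.x0_far r2.x0_far r3.x0_far r4.x0_far)+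
qed

lemma x_indep: "x \<in> {x0, x1, x2, x3, x4} \<Longrightarrow> y \<in> {x0, x1, x2, x3, x4} \<Longrightarrow> \<not> E x y"
  using v_x triangle_free[of v x y] by auto

lemma x_u: "x \<in> {x0, x1, x2, x3, x4} \<Longrightarrow> \<not> E x u \<and> \<not> E u x"
  using v_x uv triangle_free[of u v x] sym[of x u] by auto

text \<open>Otherwise \<open>z x0\<close> would form an induced 3K2 with an edge from
  \<open>x1\<close> to \<open>A0\<close> and one from \<open>x2\<close> to
  \<open>A3\<close>.\<close>

lemma hub_next:
  assumes "hub z" "E z x0"
  shows "E z x1 \<or> E z x2"
proof -
  obtain b c where bc: "b \<in> A0" "E x1 b" "c \<in> A3" "E x2 c"
    using x_left(2) x_right(3) by blast
  have "\<not> E z b" "\<not> E z c" using assms bc by (auto simp: hub_def)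
  moreover have "\<not> E x0 b" "\<not> E x0 c" "\<not> E x1 c" "\<not> E x2 b" "\<not> E c b"
    using x_far chords bc by blast+
  moreover have "\<not> E x0 x1" "\<not> E x0 x2" "\<not> E x1 x2" using x_indep by blast+
  ultimately show ?thesis
    using three_K2_free[OF assms(2) bc(2) bc(4)] sym by blast
qed

text \<open>Mirror image of \<open>hub_next\<close>, with edges from \<open>x4\<close> to
  \<open>A0\<close> and from \<open>x3\<close> to \<open>A2\<close>.\<close>

lemma hub_prev:
  assumes "hub z" "E z x0"
  shows "E z x4 \<or> E z x3"
proof -
  obtain b c where bc: "b \<in> A0" "E x4 b" "c \<in> A2" "E x3 c"
    using x_right(5) x_left(4) by blast
  have "\<not> E z b" "\<not> E z c" using assms bc by (auto simp: hub_def)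
  moreover have "\<not> E x0 b" "\<not> E x0 c" "\<not> E x4 c" "\<not> E x3 b" "\<not> E b c"
    using x_far chords bc by blast+
  moreover have "\<not> E x0 x4" "\<not> E x0 x3" "\<not> E x4 x3" using x_indep by blast+
  ultimately show ?thesis
    using three_K2_free[OF assms(2) bc(2) bc(4)] sym by blast
qed

text \<open>The edge \<open>u y\<close> must be joined to an edge from \<open>x1\<close> to
  \<open>A2\<close> or one from \<open>x0\<close> to \<open>A4\<close>, and \<open>u\<close> itself
  sees none of their ends.\<close>

lemma u_neighbour_meets:
  assumes "E u y"
  shows "E y x0 \<or> E y x1 \<or> (\<exists>b\<in>A2. E y b) \<or> (\<exists>b\<in>A4. E y b)"
proof -
  obtain b c where bc: "b \<in> A2" "E x1 b" "c \<in> A4" "E x0 c"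
    using x_right(2) x_left(1) by blast
  have "\<not> E u b" "\<not> E u c" using far bc by blast+
  moreover have "\<not> E x0 b" "\<not> E x1 c" "\<not> E b c" using x_far chords bc by blast+
  moreover have "\<not> E x1 x0" "\<not> E u x0" "\<not> E u x1" using x_indep x_u by blast+
  ultimately show ?thesis
    using three_K2_free[OF assms bc(2) bc(4)] sym bc(1,3) by blast
qed

text \<open>Among the edges \<open>z x0\<close>, \<open>x1 b\<close> with \<open>b\<close> in
  \<open>A0\<close>, and \<open>u y\<close>, the only join left by the hypotheses is
  \<open>y b\<close>.\<close>

lemma shared_right:
  assumes "hub z" "E z x0" "\<not> E z x1" "E u y" "\<not> E z y" "\<not> E y x0" "\<not> E y x1"
  shows "\<exists>b\<in>A0. E x1 b \<and> E y b"
proof -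
  obtain b where b: "b \<in> A0" "E x1 b" using x_left(2) by blast
  have "\<not> E z b" "\<not> E z u" using assms b sym by (auto simp: hub_def)
  moreover have "\<not> E x0 b" "\<not> E u b" using x_far far b by blast+
  moreover have "\<not> E x0 x1" "\<not> E x0 u" "\<not> E x1 u" using x_indep x_u by blast+
  ultimately show ?thesis
    using three_K2_free[OF assms(2) b(2) assms(4)] sym b assms by blast
qed

lemma shared_left:
  assumes "hub z" "E z x0" "\<not> E z x4" "E u y" "\<not> E z y" "\<not> E y x0" "\<not> E y x4"
  shows "\<exists>b\<in>A0. E x4 b \<and> E y b"
proof -
  obtain b where b: "b \<in> A0" "E x4 b" using x_right(5) by blast
  have "\<not> E z b" "\<not> E z u" using assms b sym by (auto simp: hub_def)
  moreover have "\<not> E x0 b" "\<not> E u b" using x_far far b by blast+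
  moreover have "\<not> E x0 x4" "\<not> E x0 u" "\<not> E x4 u" using x_indep x_u by blast+
  ultimately show ?thesis
    using three_K2_free[OF assms(2) b(2) assms(4)] sym b assms by blast
qed

end

text \<open>
  The \<open>xi\<close> seen by a hub, if any, cover all edges of the cycle \<open>x0 x1 x2 x3 x4\<close>, and so nearly do those seen by a
  neighbour \<open>y\<close> of \<open>u\<close>. If \<open>y\<close> sees the hub, the two sets are disjoint, which leaves only the
  following arrangement and its rotations.
\<close>

definition pattern :: "('a \<Rightarrow> 'a \<Rightarrow> bool) \<Rightarrow> 'a \<Rightarrow> 'a \<Rightarrow> 'a \<Rightarrow> 'a \<Rightarrow> 'a \<Rightarrow> 'a \<Rightarrow> 'a \<Rightarrow> bool" where
  "pattern E z y x0 x1 x2 x3 x4 \<longleftrightarrow>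
     E z x0 \<and> E z x2 \<and> E z x3 \<and> \<not> E z x1 \<and> \<not> E z x4 \<and>
     E y x1 \<and> E y x4 \<and> \<not> E y x0 \<and> \<not> E y x2 \<and> \<not> E y x3"

section \<open>Compatibility of the patterns of different hubs\<close>

context five_ring
begin

lemma ex_pattern:
  assumes "hub z" "E u y" "E z y" "E z x0 \<or> E z x1 \<or> E z x2 \<or> E z x3 \<or> E z x4"
  shows "pattern E z y x0 x1 x2 x3 x4 \<or> pattern E z y x1 x2 x3 x4 x0 \<or>
    pattern E z y x2 x3 x4 x0 x1 \<or> pattern E z y x3 x4 x0 x1 x2 \<or> pattern E z y x4 x0 x1 x2 x3"
proof -
  interpret r1: five_ring E u v A1 A2 A3 A4 A0 x1 x2 x3 x4 x0 by (rule rotate)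
  interpret r2: five_ring E u v A2 A3 A4 A0 A1 x2 x3 x4 x0 x1 by (rule r1.rotate)
  interpret r3: five_ring E u v A3 A4 A0 A1 A2 x3 x4 x0 x1 x2 by (rule r2.rotate)
  interpret r4: five_ring E u v A4 A0 A1 A2 A3 x4 x0 x1 x2 x3 by (rule r3.rotate)
  have hubs: "r1.hub z" "r2.hub z" "r3.hub z" "r4.hub z"
    using assms(1) by (auto simp: hub_def r1.hub_def r2.hub_def r3.hub_def r4.hub_def)
  note nb = u_neighbour_meets[OF assms(2)] r1.u_neighbour_meets[OF assms(2)] r2.u_neighbour_meets[OF assms(2)]
     r3.u_neighbour_meets[OF assms(2)] r4.u_neighbour_meets[OF assms(2)]
  note hn = hub_next[OF assms(1)] r1.hub_next[OF hubs(1)] r2.hub_next[OF hubs(2)]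
    r3.hub_next[OF hubs(3)] r4.hub_next[OF hubs(4)]
  note hp = hub_prev[OF assms(1)] r1.hub_prev[OF hubs(1)] r2.hub_prev[OF hubs(2)]
    r3.hub_prev[OF hubs(3)] r4.hub_prev[OF hubs(4)]
  \<comment> \<open>With \<open>T\<close> the claim becomes propositional in the adjacencies of
    \<open>z\<close> and \<open>y\<close> to the \<open>xi\<close> and in which \<open>Ai\<close>
    are touched by \<open>y\<close>.\<close>
  define T where "T S \<longleftrightarrow> (\<exists>b\<in>S. E y b)" for S
  have t: "\<not> (T A0 \<and> T A1)" "\<not> (T A1 \<and> T A2)" "\<not> (T A2 \<and> T A3)" "\<not> (T A3 \<and> T A4)" "\<not> (T A4 \<and> T A0)"
    unfolding T_def using touch r1.touch r2.touch r3.touch r4.touch by blast+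
  have d: "\<not> (E z x \<and> E y x)" for x
    using triangle_free[OF assms(3)] by blast
  show ?thesis
    unfolding pattern_def
    using nb[folded T_def] hn hp t d[of x0] d[of x1] d[of x2] d[of x3] d[of x4] assms(4)
    by argo
qed

text \<open>Both \<open>y\<close> and \<open>y'\<close> touch \<open>A3\<close>, and
  \<open>y\<close> is forced to touch \<open>A1\<close> as well. Then \<open>v x3\<close>, an edge
  from \<open>y\<close> to \<open>A1\<close> and one from \<open>y'\<close> to \<open>A3\<close>
  form an induced 3K2.\<close>

lemma no_adjacent_patterns:
  assumes "hub z" "E u y" "E z y" "pattern E z y x0 x1 x2 x3 x4"
    and "hub z'" "E u y'" "E z' y'" "pattern E z' y' x1 x2 x3 x4 x0"
  shows False
proof -
  interpret r1: five_ring E u v A1 A2 A3 A4 A0 x1 x2 x3 x4 x0 by (rule rotate)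
  interpret r2: five_ring E u v A2 A3 A4 A0 A1 x2 x3 x4 x0 x1 by (rule r1.rotate)
  interpret r3: five_ring E u v A3 A4 A0 A1 A2 x3 x4 x0 x1 x2 by (rule r2.rotate)
  interpret r4: five_ring E u v A4 A0 A1 A2 A3 x4 x0 x1 x2 x3 by (rule r3.rotate)
  have h: "r3.hub z" "r3.hub z'" using assms(1,5) by (auto simp: hub_def r3.hub_def)
  note P = assms(4,8)[unfolded pattern_def]
  have ns: "\<not> E z y'" "\<not> E z' y" "\<not> E y y'"
    using P assms(2,6) sym triangle_free by blast+
  obtain b where b: "b \<in> A3" "E x4 b" "E y' b"
    using r3.shared_right[OF h(1) _ _ assms(6)] P ns by blast
  obtain b' where b': "b' \<in> A3" "E y b'"
    using r3.shared_left[OF h(2) _ _ assms(2)] P ns by blast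
  obtain c where c: "c \<in> A1" "E y c"
    using r2.u_neighbour_meets[OF assms(2)] P b' r3.touch by blast
  have "\<not> E y' c"
    using r3.u_neighbour_meets[OF assms(6)] P b c touch r2.touch by blast
  moreover have "\<not> E y b" using P b triangle_free by blast
  moreover have "\<not> E v c" "\<not> E v b" "\<not> E x3 c" "\<not> E x3 b" "\<not> E c b"
    using far x_far chords b c by blast+
  moreover have "\<not> E v y" "\<not> E v y'" using uv assms(2,6) sym triangle_free by blast+
  ultimately show False
    using three_K2_free[OF v_x(4) c(2) b(3)] P ns sym by blast
qed

text \<open>Here the induced 3K2 consists of \<open>v x0\<close>, an edge from \<open>y\<close> to
  \<open>A2\<close> and an edge from \<open>y'\<close> to \<open>A0\<close>.\<close>

lemma no_distant_patterns:
  assumes "hub z" "E u y" "E z y" "pattern E z y x0 x1 x2 x3 x4"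
    and "hub z'" "E u y'" "E z' y'" "pattern E z' y' x2 x3 x4 x0 x1"
  shows False
proof -
  interpret r1: five_ring E u v A1 A2 A3 A4 A0 x1 x2 x3 x4 x0 by (rule rotate)
  interpret r2: five_ring E u v A2 A3 A4 A0 A1 x2 x3 x4 x0 x1 by (rule r1.rotate)
  interpret r3: five_ring E u v A3 A4 A0 A1 A2 x3 x4 x0 x1 x2 by (rule r2.rotate)
  interpret r4: five_ring E u v A4 A0 A1 A2 A3 x4 x0 x1 x2 x3 by (rule r3.rotate)
  have h: "r2.hub z'" using assms(5) by (auto simp: hub_def r2.hub_def)
  note P = assms(4,8)[unfolded pattern_def]
  have ns: "\<not> E z y'" "\<not> E z' y" "\<not> E y y'"
    using P assms(2,6) sym triangle_free by blast+
  obtain b where b: "b \<in> A0" "E y' b"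
    using shared_left[OF assms(1) _ _ assms(6)] P ns by blast
  obtain c where c: "c \<in> A2" "E y c"
    using r2.shared_right[OF h _ _ assms(2)] P ns by blast
  have "\<not> E y b"
    using r2.u_neighbour_meets[OF assms(2)] P b c r1.touch r4.touch by blast
  moreover have "\<not> E y' c"
    using r4.u_neighbour_meets[OF assms(6)] P b c touch r2.touch by blast
  moreover have "\<not> E v c" "\<not> E v b" "\<not> E x0 c" "\<not> E x0 b" "\<not> E b c"
    using far x_far chords b c by blast+
  moreover have "\<not> E v y" "\<not> E v y'" using uv assms(2,6) sym triangle_free by blast+
  ultimately show False
    using three_K2_free[OF v_x(1) c(2) b(2)] P ns sym by blast
qed

text \<open>Two positions on a five-cycle are equal or at distance one or two, so up to exchanging
  the hubs the two previous lemmas exclude every other position. A pattern in the same position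
  misses \<open>x1\<close>.\<close>

lemma pattern_excludes:
  assumes z: "hub z" "E u y" "E z y" "pattern E z y x0 x1 x2 x3 x4"
    and z': "hub z'" "E u y'" "E z' y'"
  shows "\<not> E z' x1"
proof
  interpret r1: five_ring E u v A1 A2 A3 A4 A0 x1 x2 x3 x4 x0 by (rule rotate)
  interpret r2: five_ring E u v A2 A3 A4 A0 A1 x2 x3 x4 x0 x1 by (rule r1.rotate)
  interpret r3: five_ring E u v A3 A4 A0 A1 A2 x3 x4 x0 x1 x2 by (rule r2.rotate)
  interpret r4: five_ring E u v A4 A0 A1 A2 A3 x4 x0 x1 x2 x3 by (rule r3.rotate)
  have h: "r3.hub z" "r3.hub z'" "r4.hub z" "r4.hub z'"
    using z(1) z'(1) by (auto simp: hub_def r3.hub_def r4.hub_def)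
  assume "E z' x1"
  then consider "pattern E z' y' x1 x2 x3 x4 x0" | "pattern E z' y' x2 x3 x4 x0 x1"
    | "pattern E z' y' x3 x4 x0 x1 x2" | "pattern E z' y' x4 x0 x1 x2 x3"
    using ex_pattern[OF z'] unfolding pattern_def by blast
  then show False
  proof cases
    case 1
    then show ?thesis by (rule no_adjacent_patterns[OF z z'])
  next
    case 2
    then show ?thesis by (rule no_distant_patterns[OF z z'])
  next
    case 3
    then show ?thesis by (rule r3.no_distant_patterns[OF h(2) z'(2,3) _ h(1) z(2-4)])
  next
    case 4
    then show ?thesis by (rule r4.no_adjacent_patterns[OF h(4) z'(2,3) _ h(3) z(2-4)])
  qed
qed

text \<open>A hub with a neighbour among those of \<open>u\<close> that sees some \<open>xi\<close>
  has a pattern, and the index after the start of that pattern is then missed by all such hubs. This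
  yields a rotation of the colouring that works.\<close>

lemma ex_avoided:
  "\<exists>x\<in>{x0, x1, x2, x3, x4}. \<forall>z y. hub z \<longrightarrow> E u y \<longrightarrow> E z y \<longrightarrow> \<not> E z x"
proof (rule ccontr)
  interpret r1: five_ring E u v A1 A2 A3 A4 A0 x1 x2 x3 x4 x0 by (rule rotate)
  interpret r2: five_ring E u v A2 A3 A4 A0 A1 x2 x3 x4 x0 x1 by (rule r1.rotate)
  interpret r3: five_ring E u v A3 A4 A0 A1 A2 x3 x4 x0 x1 x2 by (rule r2.rotate)
  interpret r4: five_ring E u v A4 A0 A1 A2 A3 x4 x0 x1 x2 x3 by (rule r3.rotate)
  have h: "r1.hub = hub" "r2.hub = hub" "r3.hub = hub" "r4.hub = hub"
    by (auto simp: fun_eq_iff hub_def r1.hub_def r2.hub_def r3.hub_def r4.hub_def)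
  note excl = pattern_excludes r1.pattern_excludes[unfolded h] r2.pattern_excludes[unfolded h]
    r3.pattern_excludes[unfolded h] r4.pattern_excludes[unfolded h]
  assume "\<not> ?thesis"
  then have all: "\<exists>z y. hub z \<and> E u y \<and> E z y \<and> E z x" if "x \<in> {x0, x1, x2, x3, x4}" for x
    using that by blast
  then obtain z y where zy: "hub z" "E u y" "E z y" "E z x0" by blast
  have "\<not> pattern E z y x0 x1 x2 x3 x4" using all[of x1] excl(1)[OF zy(1-3)] by auto
  moreover have "\<not> pattern E z y x1 x2 x3 x4 x0" using all[of x2] excl(2)[OF zy(1-3)] by auto
  moreover have "\<not> pattern E z y x2 x3 x4 x0 x1" using all[of x3] excl(3)[OF zy(1-3)] by auto
  moreover have "\<not> pattern E z y x3 x4 x0 x1 x2" using all[of x4] excl(4)[OF zy(1-3)] by auto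
  moreover have "\<not> pattern E z y x4 x0 x1 x2 x3" using all[of x0] excl(5)[OF zy(1-3)] by auto
  ultimately show False
    using ex_pattern[OF zy(1-3)] zy(4) by simp
qed

end

text \<open>The two colours grow from one edge \<open>ab\<close>. Vertices that see neither end are
  independent, since two of them joined by an edge would form an induced 2K2 with
  \<open>ab\<close>.\<close>

lemma two_colourable_if_no_five_cycle:
  assumes sym: "\<And>x y. E x y \<Longrightarrow> E y x" and triangle_free: "\<And>x y z. E x y \<Longrightarrow> E y z \<Longrightarrow> \<not> E x z"
    and two: "\<And>a b c d. \<lbrakk>a \<in> A; b \<in> A; c \<in> A; d \<in> A; E a b; E c d\<rbrakk> \<Longrightarrow> E a c \<or> E a d \<or> E b c \<or> E b d"
    and no_cycle: "\<not> (\<exists>a\<in>A. \<exists>b\<in>A. \<exists>c\<in>A. \<exists>d\<in>A. \<exists>e\<in>A. E a b \<and> E b c \<and> E c d \<and> E d e \<and> E e a)"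
  shows "colourable E A 2"
proof (cases "\<exists>a\<in>A. \<exists>b\<in>A. E a b")
  case False
  then have "colourable E A 1" by (intro colourable_indep) blast
  then show ?thesis by (rule colourable_mono) simp
next
  case True
  then obtain a b where ab: "a \<in> A" "b \<in> A" "E a b" by blast
  define far where "far r \<longleftrightarrow> \<not> E a r \<and> \<not> E b r" for r
  \<comment> \<open>A vertex far from \<open>ab\<close> avoids the colour 0 of the neighbours of
    \<open>a\<close> it may see. If it then clashed with a neighbour of \<open>b\<close>, there
    would be a closed walk of length five through \<open>a\<close> and \<open>b\<close>.\<close>
  define c :: "'a \<Rightarrow> nat" where
    "c x = (if E a x then 0 else if E b x then 1 else if \<exists>s\<in>A. E a s \<and> E x s then 1 else 0)" for x
  have clash: "c x \<noteq> c y" if "x \<in> A" "y \<in> A" "E x y" "E a x \<or> (\<not> E a y \<and> E b x)" for x y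
    using that(4)
  proof
    assume ax: "E a x"
    then have "\<not> E a y" using that(3) triangle_free by blast
    moreover have "E y x" using sym that(3) .
    ultimately show ?thesis using ax that(1) unfolding c_def by auto
  next
    assume bx: "\<not> E a y \<and> E b x"
    then have "\<not> E a x" "\<not> E b y" using that(3) ab(3) sym triangle_free by blast+
    moreover have "\<not> (\<exists>s\<in>A. E a s \<and> E y s)"
    proof
      assume "\<exists>s\<in>A. E a s \<and> E y s"
      then obtain s where "s \<in> A" "E a s" "E y s" by blast
      then have "E y s \<and> E s a \<and> E a b \<and> E b x \<and> E x y" using sym ab bx that(3) by blast
      then show False using no_cycle ab that \<open>s \<in> A\<close> by blast
    qed
    ultimately show ?thesis using bx unfolding c_def by auto
  qed
  have "c x \<noteq> c y" if xy: "x \<in> A" "y \<in> A" "E x y" for x y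
  proof (cases "far x \<and> far y")
    case True
    then show ?thesis using two[OF ab(1,2) xy(1,2) ab(3) xy(3)] unfolding far_def by blast
  next
    case False
    then show ?thesis using clash[OF xy] clash[OF xy(2,1) sym[OF xy(3)]] unfolding far_def by metis
  qed
  moreover have "c ` A \<subseteq> {..<2}" unfolding c_def by auto
  ultimately show ?thesis unfolding colourable_def by blast
qed

section \<open>The blown-up five-cycle among the vertices far from an edge\<close>

locale far_five_cycle =
  fixes E :: "'a \<Rightarrow> 'a \<Rightarrow> bool" and u v a0 a1 a2 a3 a4
  assumes sym: "E x y \<Longrightarrow> E y x"
    and triangle_free: "E x y \<Longrightarrow> E y z \<Longrightarrow> \<not> E x z"
    and three_K2_free: "E a b \<Longrightarrow> E c d \<Longrightarrow> E e f \<Longrightarrow>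
      E a c \<or> E a d \<or> E b c \<or> E b d \<or> E a e \<or> E a f \<or> E b e \<or> E b f \<or> E c e \<or> E c f \<or> E d e \<or> E d f"
    and uv: "E u v"
    and cycle: "E a0 a1" "E a1 a2" "E a2 a3" "E a3 a4" "E a4 a0"
    and cycle_far: "a \<in> {a0, a1, a2, a3, a4} \<Longrightarrow> \<not> E u a \<and> \<not> E v a"
begin

definition far :: "'a \<Rightarrow> bool" where
  "far w \<longleftrightarrow> \<not> E u w \<and> \<not> E v w"

text \<open>Applied to the two cycle neighbours of a vertex \<open>ai\<close>, this is the class of
  the blown-up cycle that contains \<open>ai\<close>; thus \<open>B a4 a1\<close> contains
  \<open>a0\<close>.\<close>

definition B :: "'a \<Rightarrow> 'a \<Rightarrow> 'a set" where
  "B p q = {w. far w \<and> E w p \<and> E w q}"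

lemma rotate: "far_five_cycle E u v a1 a2 a3 a4 a0"
proof
  show "a \<in> {a1, a2, a3, a4, a0} \<Longrightarrow> \<not> E u a \<and> \<not> E v a" for a using cycle_far by blast
qed (fact sym triangle_free three_K2_free uv cycle)+

lemma two_K2_free: "\<lbrakk>far a; far b; far c; far d; E a b; E c d\<rbrakk> \<Longrightarrow> E a c \<or> E a d \<or> E b c \<or> E b d"
  using three_K2_free[OF uv, of a b c d] unfolding far_def by blast

lemma far_a: "far a0" "far a1" "far a2" "far a3" "far a4"
  using cycle_far by (auto simp: far_def)

text \<open>The far edges \<open>a a4\<close> and \<open>b a2\<close> must be joined, and every join
  other than \<open>ab\<close> closes a triangle.\<close>

lemma B_ring: "a \<in> B a4 a1 \<Longrightarrow> b \<in> B a0 a2 \<Longrightarrow> E a b"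
  using two_K2_free[of a a4 b a2] far_a cycle triangle_free sym unfolding B_def by blast

lemma B_common: "a \<in> B p q \<Longrightarrow> b \<in> B q r \<Longrightarrow> \<not> E a b"
  using triangle_free sym unfolding B_def by blast

lemma B_indep: "a \<in> B p q \<Longrightarrow> b \<in> B p q \<Longrightarrow> \<not> E a b"
  using triangle_free sym unfolding B_def by blast

lemma neighbour_in_B: "far w \<Longrightarrow> E w a0 \<Longrightarrow> w \<in> B a0 a2 \<union> B a3 a0"
  using two_K2_free[of w a0 a2 a3] far_a cycle triangle_free sym unfolding B_def by blast

text \<open>An edge from such a \<open>z\<close> to \<open>w\<close> in \<open>B a4 a1\<close> would
  form an induced 2K2 with \<open>a2 a3\<close>.\<close>

lemma no_edge_to_B: "far z \<Longrightarrow> E z a0 \<or> E z a1 \<or> E z a2 \<or> E z a3 \<or> E z a4 \<or> \<not> (\<exists>w \<in> B a4 a1. E z w)"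
  using two_K2_free[of z _ a2 a3] far_a cycle triangle_free sym unfolding B_def by blast

definition ringset :: "'a set" where
  "ringset = B a4 a1 \<union> B a0 a2 \<union> B a1 a3 \<union> B a2 a4 \<union> B a3 a0"

lemma neighbour_in_ringset:
  assumes "far w" "E w a0 \<or> E w a1 \<or> E w a2 \<or> E w a3 \<or> E w a4"
  shows "w \<in> ringset"
proof -
  interpret r1: far_five_cycle E u v a1 a2 a3 a4 a0 by (rule rotate)
  interpret r2: far_five_cycle E u v a2 a3 a4 a0 a1 by (rule r1.rotate)
  interpret r3: far_five_cycle E u v a3 a4 a0 a1 a2 by (rule r2.rotate)
  interpret r4: far_five_cycle E u v a4 a0 a1 a2 a3 by (rule r3.rotate)
  show ?thesis
    using assms neighbour_in_B r1.neighbour_in_B r2.neighbour_in_B r3.neighbour_in_B r4.neighbour_in_B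
    unfolding ringset_def by blast
qed

text \<open>
  The classes \<open>A0\<close>; \<open>A1 \<union> A3\<close>; \<open>A2 \<union> A4\<close> of the blown-up cycle get the colours 2, 0, 1, the
  neighbours of \<open>u\<close> get 3, and a neighbour of \<open>v\<close> needs colour 2 only if it touches both \<open>A4\<close> and
  \<open>A1\<close>. A vertex isolated in the remainder gets 3 if it sees no neighbour of \<open>u\<close>, and 2 otherwise;
  the latter is what the hypothesis allows.
\<close>

lemma four_colourable_if_good:
  assumes good: "\<And>x y z. \<lbrakk>far z; z \<notin> ringset; E u y; E z y; E v x; E z x;
    \<exists>a\<in>B a3 a0. E x a; \<exists>a\<in>B a0 a2. E x a\<rbrakk> \<Longrightarrow> False"
  shows "colourable E S 4"
proof -
  interpret r1: far_five_cycle E u v a1 a2 a3 a4 a0 by (rule rotate)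
  interpret r2: far_five_cycle E u v a2 a3 a4 a0 a1 by (rule r1.rotate)
  interpret r3: far_five_cycle E u v a3 a4 a0 a1 a2 by (rule r2.rotate)
  interpret r4: far_five_cycle E u v a4 a0 a1 a2 a3 by (rule r3.rotate)
  define A0 where "A0 = B a4 a1"
  define A1 where "A1 = B a0 a2"
  define A2 where "A2 = B a1 a3"
  define A3 where "A3 = B a2 a4"
  define A4 where "A4 = B a3 a0"
  note A_defs = A0_def A1_def A2_def A3_def A4_def
  have ring: "a \<in> A0 \<Longrightarrow> b \<in> A1 \<Longrightarrow> E a b" "a \<in> A1 \<Longrightarrow> b \<in> A2 \<Longrightarrow> E a b"
      "a \<in> A2 \<Longrightarrow> b \<in> A3 \<Longrightarrow> E a b" "a \<in> A3 \<Longrightarrow> b \<in> A4 \<Longrightarrow> E a b" "a \<in> A4 \<Longrightarrow> b \<in> A0 \<Longrightarrow> E a b" for a b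
    unfolding A_defs by (fact B_ring r1.B_ring r2.B_ring r3.B_ring r4.B_ring)+
  have indep: "\<not> E a b" if "(a \<in> A0 \<and> b \<in> A0) \<or> (a \<in> A1 \<union> A3 \<and> b \<in> A1 \<union> A3) \<or> (a \<in> A2 \<union> A4 \<and> b \<in> A2 \<union> A4)" for a b
    using that B_indep B_common sym unfolding A_defs by blast
  \<comment> \<open>First \<open>w\<close> is shown to lie outside \<open>ringset\<close> too, so
    neither end of \<open>zw\<close> sees \<open>a0\<close> or \<open>a1\<close>, and
    \<open>zw\<close> with \<open>a0 a1\<close> would be an induced 2K2 among far vertices.\<close>
  have iso: "\<not> E z w" if z: "far z" "z \<notin> ringset" and w: "far w" for z w
  proof
    assume zw: "E z w"
    have nz: "\<not> (E z a0 \<or> E z a1 \<or> E z a2 \<or> E z a3 \<or> E z a4)" using neighbour_in_ringset z by blast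
    then have "w \<notin> ringset"
      using no_edge_to_B[OF z(1)] r1.no_edge_to_B[OF z(1)] r2.no_edge_to_B[OF z(1)]
        r3.no_edge_to_B[OF z(1)] r4.no_edge_to_B[OF z(1)] zw unfolding ringset_def by blast
    then have "\<not> (E w a0 \<or> E w a1)" using neighbour_in_ringset w by blast
    then show False using two_K2_free[OF z(1) w far_a(1,2) zw cycle(1)] nz by blast
  qed
  define T where "T x A \<longleftrightarrow> (\<exists>a\<in>A. E x a)" for x A
  define c :: "'a \<Rightarrow> nat" where "c w =
    (if E u w then 3
     else if E v w then (if T w A4 \<and> T w A1 then 2 else if T w A1 \<or> T w A3 then 1 else 0)
     else if w \<in> A0 then 2 else if w \<in> A1 \<union> A3 then 0 else if w \<in> A2 \<union> A4 then 1
     else if \<exists>y. E u y \<and> E w y then 2 else 3)" for w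
  have rs: "w \<in> ringset \<longleftrightarrow> w \<in> A0 \<or> w \<in> A1 \<or> w \<in> A2 \<or> w \<in> A3 \<or> w \<in> A4" for w
    unfolding ringset_def A_defs by blast
  have T_touch: "\<not> (T w A0 \<and> T w A1)" "\<not> (T w A1 \<and> T w A2)" "\<not> (T w A2 \<and> T w A3)"
    "\<not> (T w A3 \<and> T w A4)" "\<not> (T w A4 \<and> T w A0)" for w
    using ring triangle_free unfolding T_def by blast+
  have from_u: "c x \<noteq> c y" if "E x y" "E u x" for x y
  proof -
    have "\<not> E u y" "E y x" using that sym triangle_free by blast+
    then have "c y \<noteq> 3" using that unfolding c_def by auto
    then show ?thesis using that unfolding c_def by auto
  qed
  have from_v: "c x \<noteq> c y" if xy: "E x y" "\<not> E u x" "\<not> E u y" "E v x" for x y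
  proof -
    have nv: "\<not> E v y" using xy triangle_free by blast
    then have y: "far y" using xy unfolding far_def by blast
    have cx: "c x = (if T x A4 \<and> T x A1 then 2 else if T x A1 \<or> T x A3 then 1 else 0)"
      using xy unfolding c_def by simp
    have cy: "c y = (if y \<in> A0 then 2 else if y \<in> A1 \<union> A3 then 0 else if y \<in> A2 \<union> A4 then 1
     else if \<exists>t. E u t \<and> E y t then 2 else 3)" using xy nv unfolding c_def by simp
    have Ty: "y \<in> P \<Longrightarrow> T x P" for P using xy(1) unfolding T_def by blast
    show ?thesis
    proof (cases "y \<in> ringset")
      case True
      then show ?thesis using cx cy Ty T_touch[of x] unfolding rs by auto
    next
      case False
      then have "\<not> (T x A4 \<and> T x A1 \<and> (\<exists>t. E u t \<and> E y t))"
        using good[OF y False _ _ xy(4)] sym[OF xy(1)] unfolding T_def A_defs by blast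
      then show ?thesis using cx cy False unfolding rs by auto
    qed
  qed
  have "c x \<noteq> c y" if xy: "E x y" for x y
  proof (cases "far x \<and> far y")
    case True
    then have "x \<in> ringset" "y \<in> ringset" using iso[of x y] iso[of y x] xy sym by blast+
    moreover have "c w = (if w \<in> A0 then 2 else if w \<in> A1 \<union> A3 then 0 else 1)"
      if "far w" "w \<in> ringset" for w
      using that unfolding far_def rs c_def by auto
    ultimately have "c x = (if x \<in> A0 then 2 else if x \<in> A1 \<union> A3 then 0 else 1)"
      "c y = (if y \<in> A0 then 2 else if y \<in> A1 \<union> A3 then 0 else 1)"
      and "x \<in> A0 \<or> x \<in> A1 \<union> A3 \<or> x \<in> A2 \<union> A4" "y \<in> A0 \<or> y \<in> A1 \<union> A3 \<or> y \<in> A2 \<union> A4"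
      using True rs by blast+
    then show ?thesis using indep[of x y] xy by (auto split: if_splits)
  next
    case False
    then show ?thesis
      using from_u[OF xy] from_u[OF sym[OF xy]] from_v[OF xy] from_v[OF sym[OF xy]]
      unfolding far_def by metis
  qed
  moreover have "c ` S \<subseteq> {..<4}" unfolding c_def by auto
  ultimately show ?thesis unfolding colourable_def by blast
qed

text \<open>If there were no colouring, each of the five rotations of
  \<open>four_colourable_if_good\<close> would yield an obstacle. The five obstacles turn the
  blown-up cycle into a \<open>five_ring\<close>, and \<open>ex_avoided\<close> shows that one of
  them is none.\<close>

lemma four_colourable: "colourable E S 4"
proof (rule ccontr)
  interpret r1: far_five_cycle E u v a1 a2 a3 a4 a0 by (rule rotate)
  interpret r2: far_five_cycle E u v a2 a3 a4 a0 a1 by (rule r1.rotate)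
  interpret r3: far_five_cycle E u v a3 a4 a0 a1 a2 by (rule r2.rotate)
  interpret r4: far_five_cycle E u v a4 a0 a1 a2 a3 by (rule r3.rotate)
  assume neg: "\<not> colourable E S 4"
  have rs: "r1.ringset = ringset" "r2.ringset = ringset" "r3.ringset = ringset" "r4.ringset = ringset"
    unfolding ringset_def r1.ringset_def r2.ringset_def r3.ringset_def r4.ringset_def by blast+
  define seen where "seen z \<longleftrightarrow> far z \<and> z \<notin> ringset \<and> (\<exists>y. E u y \<and> E z y)" for z
  \<comment> \<open>An obstacle to one rotation: \<open>P\<close> and \<open>Q\<close> are the
    classes on either side of the one that gets colour 2.\<close>
  define twin_like where "twin_like x P Q \<longleftrightarrow> E v x \<and> (\<exists>z. seen z \<and> E z x) \<and> (\<exists>a\<in>P. E x a) \<and> (\<exists>a\<in>Q. E x a)" for x P Q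
  have "\<exists>x. twin_like x (B a3 a0) (B a0 a2)"
    using four_colourable_if_good neg unfolding twin_like_def seen_def by blast
  then obtain x0 where x0: "twin_like x0 (B a3 a0) (B a0 a2)" ..
  have "\<exists>x. twin_like x (B a4 a1) (B a1 a3)"
    using r1.four_colourable_if_good neg unfolding twin_like_def seen_def rs by blast
  then obtain x1 where x1: "twin_like x1 (B a4 a1) (B a1 a3)" ..
  have "\<exists>x. twin_like x (B a0 a2) (B a2 a4)"
    using r2.four_colourable_if_good neg unfolding twin_like_def seen_def rs by blast
  then obtain x2 where x2: "twin_like x2 (B a0 a2) (B a2 a4)" ..
  have "\<exists>x. twin_like x (B a1 a3) (B a3 a0)"
    using r3.four_colourable_if_good neg unfolding twin_like_def seen_def rs by blast
  then obtain x3 where x3: "twin_like x3 (B a1 a3) (B a3 a0)" ..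
  have "\<exists>x. twin_like x (B a2 a4) (B a4 a1)"
    using r4.four_colourable_if_good neg unfolding twin_like_def seen_def rs by blast
  then obtain x4 where x4: "twin_like x4 (B a2 a4) (B a4 a1)" ..
  note prs = x0 x1 x2 x3 x4
  interpret R: five_ring E u v "B a4 a1" "B a0 a2" "B a1 a3" "B a2 a4" "B a3 a0" x0 x1 x2 x3 x4
  proof
    show "a \<in> B a4 a1 \<Longrightarrow> b \<in> B a0 a2 \<Longrightarrow> E a b" "a \<in> B a0 a2 \<Longrightarrow> b \<in> B a1 a3 \<Longrightarrow> E a b"
      "a \<in> B a1 a3 \<Longrightarrow> b \<in> B a2 a4 \<Longrightarrow> E a b" "a \<in> B a2 a4 \<Longrightarrow> b \<in> B a3 a0 \<Longrightarrow> E a b"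
      "a \<in> B a3 a0 \<Longrightarrow> b \<in> B a4 a1 \<Longrightarrow> E a b" for a b
      by (fact B_ring r1.B_ring r2.B_ring r3.B_ring r4.B_ring)+
    show "a \<in> B a4 a1 \<union> B a0 a2 \<union> B a1 a3 \<union> B a2 a4 \<union> B a3 a0 \<Longrightarrow> \<not> E u a \<and> \<not> E v a" for a
      unfolding B_def far_def by blast
  qed (fact sym triangle_free three_K2_free uv B_common | use prs in \<open>unfold twin_like_def, blast\<close>)+
  have hub: "R.hub z" if "seen z" for z
  proof -
    have nz: "\<not> (E z a0 \<or> E z a1 \<or> E z a2 \<or> E z a3 \<or> E z a4)" and z: "far z"
      using neighbour_in_ringset that unfolding seen_def by blast+
    then show ?thesis
      using no_edge_to_B[OF z(1)] r1.no_edge_to_B[OF z(1)] r2.no_edge_to_B[OF z(1)]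
        r3.no_edge_to_B[OF z(1)] r4.no_edge_to_B[OF z(1)] unfolding R.hub_def far_def by blast
  qed
  have "\<exists>z y. R.hub z \<and> E u y \<and> E z y \<and> E z x" if "x \<in> {x0, x1, x2, x3, x4}" for x
    using that prs hub unfolding twin_like_def seen_def by blast
  then show False using R.ex_avoided by blast
qed

end

text \<open>The vertices far from an edge \<open>uv\<close> contain no induced 2K2. Without a
  five-cycle they need two colours, and the independent neighbourhoods of \<open>u\<close> and
  \<open>v\<close> one each; with a five-cycle the ring argument applies.\<close>

lemma triangle_3K2_free_colourable:
  assumes sym: "\<And>x y. E x y \<Longrightarrow> E y x" and triangle_free: "\<And>x y z. E x y \<Longrightarrow> E y z \<Longrightarrow> \<not> E x z"
    and three_K2_free: "\<And>a b c d e f. E a b \<Longrightarrow> E c d \<Longrightarrow> E e f \<Longrightarrow>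
      E a c \<or> E a d \<or> E b c \<or> E b d \<or> E a e \<or> E a f \<or> E b e \<or> E b f \<or> E c e \<or> E c f \<or> E d e \<or> E d f"
  shows "colourable E S 4"
proof (cases "\<exists>u v. E u v")
  case False
  then have "colourable E S 1" by (intro colourable_indep) blast
  then show ?thesis by (rule colourable_mono) simp
next
  case True
  then obtain u v where uv: "E u v" by blast
  define A where "A = {w. \<not> E u w \<and> \<not> E v w}"
  show ?thesis
  proof (cases "\<exists>a\<in>A. \<exists>b\<in>A. \<exists>c\<in>A. \<exists>d\<in>A. \<exists>e\<in>A. E a b \<and> E b c \<and> E c d \<and> E d e \<and> E e a")
    case True
    then obtain a b c d e where sub: "{a, b, c, d, e} \<subseteq> A" and cyc: "E a b" "E b c" "E c d" "E d e" "E e a"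
      by blast
    interpret far_five_cycle E u v a b c d e
    proof
      show "\<not> E u x \<and> \<not> E v x" if "x \<in> {a, b, c, d, e}" for x
        using that sub unfolding A_def by blast
    qed (fact sym triangle_free three_K2_free uv cyc)+
    show ?thesis by (rule four_colourable)
  next
    case False
    have "colourable E A 2"
    proof (rule two_colourable_if_no_five_cycle[OF sym triangle_free _ False])
      show "E a c \<or> E a d \<or> E b c \<or> E b d" if "a \<in> A" "b \<in> A" "c \<in> A" "d \<in> A" "E a b" "E c d" for a b c d
        using three_K2_free[OF uv that(5,6)] that unfolding A_def by blast
    qed
    moreover have "colourable E {w. E x w} 1" for x
      by (rule colourable_indep) (use triangle_free in blast)
    ultimately have "colourable E ((A \<union> {w. E u w}) \<union> {w. E v w}) (2 + 1 + 1)"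
      by (intro colourable_union)
    then show ?thesis by (rule colourable_subset[THEN colourable_mono]) (auto simp: A_def)
  qed
qed

section \<open>The bound\<close>

context adjacency
begin

text \<open>An induced matching of \<open>p\<close> edges among these vertices would be extended by
  \<open>uv\<close>, placed at index \<open>p\<close>.\<close>

lemma matching_free_far:
  assumes "matching_free E S (Suc p)" "u \<in> S" "v \<in> S" "E u v"
  shows "matching_free E {w \<in> S. \<not> E u w \<and> \<not> E v w} p"
  unfolding matching_free_def
proof (safe)
  fix f g
  assume fg: "\<forall>i<p. f i \<in> {w \<in> S. \<not> E u w \<and> \<not> E v w} \<and> g i \<in> {w \<in> S. \<not> E u w \<and> \<not> E v w} \<and> E (f i) (g i) \<and>
     (\<forall>j<p. j \<noteq> i \<longrightarrow> \<not> E (f i) (f j) \<and> \<not> E (f i) (g j) \<and> \<not> E (g i) (g j))"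
  then have "\<not> E (f i) u" "\<not> E (f i) v" "\<not> E (g i) u" "\<not> E (g i) v" if "i < p" for i
    using sym that by blast+
  then have "\<forall>i<Suc p. (f(p := u)) i \<in> S \<and> (g(p := v)) i \<in> S \<and> E ((f(p := u)) i) ((g(p := v)) i) \<and>
     (\<forall>j<Suc p. j \<noteq> i \<longrightarrow> \<not> E ((f(p := u)) i) ((f(p := u)) j) \<and> \<not> E ((f(p := u)) i) ((g(p := v)) j) \<and>
       \<not> E ((g(p := v)) i) ((g(p := v)) j))"
    using fg assms(2-4) by (auto simp: less_Suc_eq)
  then show False using assms(1) unfolding matching_free_def by blast
qed

lemma not_matching_free_0: "\<not> matching_free E S 0"
  by (simp add: matching_free_def)

text \<open>Removing both edges with \<open>matching_free_far\<close> would leave a set free of the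
  empty matching, which is impossible.\<close>

lemma matching_free_2:
  assumes "matching_free E S 2" "a \<in> S" "b \<in> S" "c \<in> S" "d \<in> S" "E a b" "E c d"
  shows "E a c \<or> E a d \<or> E b c \<or> E b d"
proof (rule ccontr)
  assume neg: "\<not> ?thesis"
  let ?A = "{w \<in> S. \<not> E a w \<and> \<not> E b w}"
  have "matching_free E ?A (Suc 0)"
    by (rule matching_free_far) (use assms in \<open>auto simp: numeral_2_eq_2\<close>)
  from matching_free_far[OF this, of c d] neg show False
    using assms not_matching_free_0 by blast
qed

lemma matching_free_3:
  assumes "matching_free E S 3" "{a, b, c, d, e, f} \<subseteq> S" "E a b" "E c d" "E e f"
  shows "E a c \<or> E a d \<or> E b c \<or> E b d \<or> E a e \<or> E a f \<or> E b e \<or> E b f \<or> E c e \<or> E c f \<or> E d e \<or> E d f"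
proof -
  have "matching_free E {w \<in> S. \<not> E a w \<and> \<not> E b w} 2"
    by (rule matching_free_far) (use assms in \<open>auto simp: numeral_3_eq_3 numeral_2_eq_2\<close>)
  from matching_free_2[OF this, of c d e f] show ?thesis using assms(2,4,5) by blast
qed

lemma triangle_free_if_cliques_le:
  assumes "cliques_le E S 2" "x \<in> S" "y \<in> S" "z \<in> S" "E x y" "E y z"
  shows "\<not> E x z"
proof
  assume "E x z"
  then have "pairwise E {x, y, z}" "card {x, y, z} = 3"
    using assms(5,6) sym irrefl by (auto simp: pairwise_def card_insert_if dest: sym)
  then show False
    using assms(1)[unfolded cliques_le_def, rule_format, of "{x, y, z}"] assms(2-4) by simp
qed

text \<open>The neighbourhood has no induced P4, and its cliques extend by \<open>u\<close>, which
  accounts for the \<open>- 1\<close>.\<close>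

lemma neighbours_colourable:
  assumes "finite S" "gem_free E S" "cliques_le E S m" "u \<in> S"
  shows "colourable E {w \<in> S. E u w} (m - 1)"
proof (rule path4_free_colourable)
  show "finite {w \<in> S. E u w}" using assms(1) by simp
  show "path4_free E {w \<in> S. E u w}" using assms(2,4) by (simp add: gem_free_def)
  show "cliques_le E {w \<in> S. E u w} (m - 1)"
    unfolding cliques_le_def
  proof (intro allI impI)
    fix K assume K: "K \<subseteq> {w \<in> S. E u w}" "pairwise E K"
    then have "pairwise E (insert u K)" "u \<notin> K"
      using sym irrefl by (auto simp: pairwise_insert)
    moreover have "finite K" "K \<subseteq> S" using K(1) assms(1) by (auto intro: finite_subset)
    ultimately show "card K \<le> m - 1"
      using assms(3)[unfolded cliques_le_def, rule_format, of "insert u K"] assms(4) by simp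
  qed
qed

lemma colourable_edge_step:
  assumes "finite S" "gem_free E S" "cliques_le E S m" "u \<in> S" "v \<in> S"
    and "colourable E {w \<in> S. \<not> E u w \<and> \<not> E v w} k"
  shows "colourable E S (k + (m - 1) + (m - 1))"
proof -
  have "colourable E ({w \<in> S. \<not> E u w \<and> \<not> E v w} \<union> {w \<in> S. E u w} \<union> {w \<in> S. E v w}) (k + (m - 1) + (m - 1))"
    by (intro colourable_union neighbours_colourable assms)
  then show ?thesis by (rule colourable_subset) blast
qed

lemma two_K2_gem_free_colourable:
  assumes "finite S" "gem_free E S" "cliques_le E S m" "matching_free E S 2"
  shows "colourable E S (max 3 m)"
proof -
  \<comment> \<open>Since \<open>m\<close> is only an upper bound for the clique sizes, the argument
    starts from a clique of actual maximum size.\<close>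
  let ?C = "{K. K \<subseteq> S \<and> pairwise E K}"
  have fin: "finite (card ` ?C)"
    using assms(1) by (auto intro: finite_imageI finite_subset[of _ "Pow S"])
  have "{} \<in> ?C" by simp
  then have "Max (card ` ?C) \<in> card ` ?C" by (intro Max_in fin) blast
  then obtain K where K: "K \<subseteq> S" "pairwise E K" "card K = Max (card ` ?C)" by auto
  have max: "cliques_le E S (card K)"
    unfolding cliques_le_def K(3) using Max_ge[OF fin] by blast
  have Km: "card K \<le> m" using assms(3) K unfolding cliques_le_def by blast
  show ?thesis
  proof (cases "card K \<ge> 3")
    case True
    interpret two_K2_gem_free E S K
      by unfold_locales (use assms K max True matching_free_2 in auto)
    show ?thesis using colourable Km by (rule colourable_mono[OF _ order_trans]) simp
  next
    case False
    then have "card K \<le> 2" by simp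
    then have c2: "cliques_le E S 2" using max unfolding cliques_le_def by (meson order_trans)
    have "colourable E S 3"
    proof (cases "\<exists>u\<in>S. \<exists>v\<in>S. E u v")
      case True
      then obtain u v where uv: "u \<in> S" "v \<in> S" "E u v" by blast
      \<comment> \<open>One colour for the far vertices and one for each neighbourhood make
        three.\<close>
      have "colourable E {w \<in> S. \<not> E u w \<and> \<not> E v w} 1"
        by (rule colourable_indep) (use matching_free_2[OF assms(4)] uv in blast)
      from colourable_edge_step[OF assms(1,2) c2 uv(1,2) this] show ?thesis by (simp add: numeral_3_eq_3)
    next
      case False
      then have "colourable E S 1" by (intro colourable_indep) blast
      then show ?thesis by (rule colourable_mono) simp
    qed
    then show ?thesis by (rule colourable_mono) simp
  qed
qed

lemma triangle_3K2_free_colourable_on: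
  assumes "cliques_le E S 2" "matching_free E S 3"
  shows "colourable E S 4"
proof -
  \<comment> \<open>The triangle-free result concerns a relation on the whole type, so adjacency is
    cut down to \<open>S\<close>.\<close>
  let ?E = "\<lambda>x y. x \<in> S \<and> y \<in> S \<and> E x y"
  have "colourable ?E S 4"
  proof (rule triangle_3K2_free_colourable)
    show "?E x y \<Longrightarrow> ?E y x" for x y using sym by blast
    show "?E x y \<Longrightarrow> ?E y z \<Longrightarrow> \<not> ?E x z" for x y z
      using triangle_free_if_cliques_le[OF assms(1)] by blast
    show "?E a c \<or> ?E a d \<or> ?E b c \<or> ?E b d \<or> ?E a e \<or> ?E a f \<or> ?E b e \<or> ?E b f \<or>
        ?E c e \<or> ?E c f \<or> ?E d e \<or> ?E d f" if "?E a b" "?E c d" "?E e f" for a b c d e f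
      using matching_free_3[OF assms(2), of a b c d e f] that by simp
  qed
  then show ?thesis by (simp add: colourable_def)
qed

lemma few_cliques_colourable:
  assumes "finite S" "cliques_le E S m" "m \<le> 1"
  shows "colourable E S m"
proof (rule path4_free_colourable[OF assms(1) _ assms(2)])
  have "\<not> E x y" if "x \<in> S" "y \<in> S" for x y
  proof
    assume "E x y"
    then have "pairwise E {x, y}" "x \<noteq> y" using sym irrefl by (auto simp: pairwise_insert)
    then show False
      using assms(2)[unfolded cliques_le_def, rule_format, of "{x, y}"] assms(3) that by simp
  qed
  then show "path4_free E S" by (auto simp: path4_free_def is_path4_def)
qed

lemma gem_bound_colourable:
  assumes "p \<ge> 2" "finite S" "gem_free E S" "cliques_le E S m" "matching_free E S p"
  shows "colourable E S (gem_bound p m)"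
  using assms
proof (induction p arbitrary: S rule: dec_induct)
  case base
  show ?case
  proof (cases "m \<le> 1")
    case True
    then have "gem_bound 2 m = m" by (subst gem_bound.simps) auto
    then show ?thesis using few_cliques_colourable[OF base(1,3) True] by simp
  next
    case False
    then have "gem_bound 2 m = max 3 m" by (subst gem_bound.simps) auto
    then show ?thesis using two_K2_gem_free_colourable base False by simp
  qed
next
  case (step n)
  show ?case
  proof (cases "m \<le> 1")
    case True
    then have "gem_bound (Suc n) m = m" by (subst gem_bound.simps) auto
    then show ?thesis using few_cliques_colourable[OF step.prems(1,3) True] by simp
  next
    case m: False
    show ?thesis
    \<comment> \<open>Here the edge step would give 3 + 1 + 1 = 5 colours while the bound is 4. In
      all other cases the bound grows by exactly \<open>2 * (m - 1)\<close>.\<close>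
    proof (cases "m = 2 \<and> n = 2")
      case True
      then show ?thesis
        using triangle_3K2_free_colourable_on[of S] step.prems gem_bound_eqs(4)[of 3]
        by (simp add: eval_nat_numeral)
    next
      case False
      have bound: "gem_bound (Suc n) m = gem_bound n m + (m - 1) + (m - 1)"
      proof (cases "m = 2")
        case True
        then show ?thesis
          using False step(1) gem_bound_eqs(4)[of n] gem_bound_eqs(4)[of "Suc n"] by simp
      next
        case False
        then show ?thesis using m step(1) gem_bound_eqs(5)[of "Suc n" m] by simp
      qed
      show ?thesis
      proof (cases "\<exists>u\<in>S. \<exists>v\<in>S. E u v")
        case True
        then obtain u v where uv: "u \<in> S" "v \<in> S" "E u v" by blast
        have "colourable E {w \<in> S. \<not> E u w \<and> \<not> E v w} (gem_bound n m)"
          by (rule step.IH) (use step.prems uv matching_free_far in \<open>auto intro: gem_free_subset cliques_le_subset\<close>)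
        then show ?thesis
          unfolding bound by (rule colourable_edge_step[OF step.prems(1-3) uv(1,2)])
      next
        case False
        then have "colourable E S 1" by (intro colourable_indep) blast
        then show ?thesis by (rule colourable_mono) (use bound m in simp)
      qed
    qed
  qed
qed

end

section \<open>From forbidden induced subgraphs to the adjacency relation\<close>

lemma not_family_free:
  fixes h :: "'b \<Rightarrow> 'a"
  assumes "pair_wf_digraph G" "pair_wf_digraph F" "F \<in> \<F>" "inj_on h (pverts F)" "h ` pverts F \<subseteq> pverts G"
    and arcs: "\<And>a b. a \<in> pverts F \<Longrightarrow> b \<in> pverts F \<Longrightarrow> (h a, h b) \<in> parcs G \<longleftrightarrow> (a, b) \<in> parcs F"
  shows "\<not> family_free \<F> G"
proof -
  interpret G: pair_wf_digraph G by fact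
  interpret F: pair_wf_digraph F by fact
  \<comment> \<open>The copy of \<open>F\<close> in \<open>G\<close> is its image under
    \<open>h\<close>, with each arc mapped as a pair. Since \<open>h\<close> preserves and reflects
    arcs, the image has all arcs of \<open>G\<close> between its vertices.\<close>
  define hom :: "('b, 'b \<times> 'b, 'a, 'a \<times> 'a) digraph_isomorphism" where
    "hom = \<lparr>iso_verts = h, iso_arcs = map_prod h h, iso_head = snd, iso_tail = fst\<rparr>"
  define H where "H = app_iso hom (with_proj F)"
  have Farcs: "parcs F \<subseteq> pverts F \<times> pverts F"
    using F.in_arcsD1 F.in_arcsD2 by auto
  have iso: "F.digraph_isomorphism hom"
    unfolding F.digraph_isomorphism_def hom_def
    using assms(4) F.wf_digraph_axioms
    by (auto intro: inj_on_subset[OF map_prod_inj_on[OF assms(4) assms(4)] Farcs])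
  have wfH: "wf_digraph H"
    unfolding H_def using F.wf_digraphI_app_iso[OF iso] .
  have "digraph_iso (with_proj F) H" unfolding digraph_iso_def H_def using iso by blast
  then have "digraph_iso H (with_proj F)" by (rule digraph_iso_swap[OF F.wf_digraph_axioms])
  moreover have "induced_subgraph H (with_proj G)"
  proof -
    have "verts H = h ` pverts F" "tail H = fst" "head H = snd"
      by (simp_all add: H_def hom_def)
    moreover have "arcs H = {e \<in> parcs G. fst e \<in> h ` pverts F \<and> snd e \<in> h ` pverts F}"
      using arcs Farcs by (auto simp: H_def hom_def map_prod_def image_iff split: prod.splits) (force)+
    ultimately show ?thesis
      using assms(5) wfH G.wf_digraph_axioms
      by (auto simp: induced_subgraph_def subgraph_def compatible_def)
  qed
  ultimately show ?thesis using assms(3) unfolding family_free_def by blast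
qed


lemma gem_free_if_family_free:
  assumes "pair_graph G" "family_free {F, gem} G"
  shows "gem_free (\<lambda>x y. (x, y) \<in> parcs G) (pverts G)"
proof (rule ccontr)
  interpret G: pair_graph G by fact
  have sym: "(x, y) \<in> parcs G \<longleftrightarrow> (y, x) \<in> parcs G" for x y
    using G.arcs_symmetric by blast
  assume "\<not> ?thesis"
  then obtain e a b c d where V: "{e, a, b, c, d} \<subseteq> pverts G"
    and e: "(e, a) \<in> parcs G" "(e, b) \<in> parcs G" "(e, c) \<in> parcs G" "(e, d) \<in> parcs G"
    and P: "is_path4 (\<lambda>x y. (x, y) \<in> parcs G) a b c d"
    unfolding gem_free_def path4_free_def by blast
  \<comment> \<open>The order follows the numbering of \<open>gem\<close>: path first, apex at
    4.\<close>
  define h :: "nat \<Rightarrow> 'a" where "h i = [a, b, c, d, e] ! i" for i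
  have h: "h 0 = a" "h 1 = b" "h 2 = c" "h 3 = d" "h 4 = e" "h (Suc 0) = b" by (simp_all add: h_def)
  have five: "{..<5::nat} = {0, 1, 2, 3, 4}" by auto
  have irr: "(x, x) \<notin> parcs G" for x using G.no_loops' by blast
  note P' = P[unfolded is_path4_def]
  have ne: "a \<noteq> b" "a \<noteq> c" "a \<noteq> d" "a \<noteq> e" "b \<noteq> c" "b \<noteq> d" "b \<noteq> e" "c \<noteq> d" "c \<noteq> e" "d \<noteq> e"
    using P' e sym irr by metis+
  have "\<not> family_free {F, gem} G"
  proof (rule not_family_free[of G gem _ h])
    show "pair_wf_digraph G" "pair_wf_digraph gem"
      using pair_graph_gem by (auto simp: pair_graph_def pair_digraph_def pair_fin_digraph_def intro: G.pair_wf_digraph)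
    show "inj_on h (pverts gem)"
      using ne ne[symmetric] by (auto simp: gem_def Let_def five inj_on_def h)
    show "h ` pverts gem \<subseteq> pverts G"
      using V by (auto simp: gem_def Let_def five h)
    show "(h x, h y) \<in> parcs G \<longleftrightarrow> (x, y) \<in> parcs gem" if "x \<in> pverts gem" "y \<in> pverts gem" for x y
    proof -
      have "x \<in> {0, 1, 2, 3, 4}" "y \<in> {0, 1, 2, 3, 4}" using that by (auto simp: gem_def Let_def five)
      moreover have "(b, a) \<in> parcs G" "(c, b) \<in> parcs G" "(d, c) \<in> parcs G" "(c, a) \<notin> parcs G"
        "(d, a) \<notin> parcs G" "(d, b) \<notin> parcs G" "(a, e) \<in> parcs G" "(b, e) \<in> parcs G"
        "(c, e) \<in> parcs G" "(d, e) \<in> parcs G"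
        using P' e sym by blast+
      ultimately show ?thesis
        using P' e irr by (elim insertE emptyE) (simp_all add: gem_def Let_def h)
    qed
  qed simp
  then show False using assms(2) by blast
qed

lemma matching_free_if_family_free:
  assumes "pair_graph G" "family_free {pK2 p, F} G"
  shows "matching_free (\<lambda>x y. (x, y) \<in> parcs G) (pverts G) p"
  unfolding matching_free_def
proof
  interpret G: pair_graph G by fact
  have sym: "(x, y) \<in> parcs G \<longleftrightarrow> (y, x) \<in> parcs G" for x y
    using G.arcs_symmetric by blast
  have irr: "(x, x) \<notin> parcs G" for x using G.no_loops' by blast
  assume "\<exists>f g. \<forall>i<p. f i \<in> pverts G \<and> g i \<in> pverts G \<and> (f i, g i) \<in> parcs G \<and> (\<forall>j<p. j \<noteq> i \<longrightarrow>
    (f i, f j) \<notin> parcs G \<and> (f i, g j) \<notin> parcs G \<and> (g i, g j) \<notin> parcs G)"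
  then obtain f g where V: "\<And>i. i < p \<Longrightarrow> f i \<in> pverts G \<and> g i \<in> pverts G"
    and E: "\<And>i. i < p \<Longrightarrow> (f i, g i) \<in> parcs G"
    and N: "\<And>i j. i < p \<Longrightarrow> j < p \<Longrightarrow> i \<noteq> j \<Longrightarrow>
      (f i, f j) \<notin> parcs G \<and> (f i, g j) \<notin> parcs G \<and> (g i, g j) \<notin> parcs G"
    by metis
  \<comment> \<open>The vertices \<open>2 * i\<close> and \<open>2 * i + 1\<close> of
    \<open>pK2 p\<close> go to the two ends of the \<open>i\<close>-th matching edge.\<close>
  define h where "h i = (if even i then f (i div 2) else g (i div 2))" for i
  have adj: "(h x, h y) \<in> parcs G \<longleftrightarrow> x div 2 = y div 2 \<and> x \<noteq> y" if "x < 2 * p" "y < 2 * p" for x y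
  proof -
    have xy: "x div 2 < p" "y div 2 < p" using that by auto
    show ?thesis
    proof (cases "x div 2 = y div 2")
      case True
      then have "even x = even y \<longleftrightarrow> x = y" by (metis bit_eq_rec)
      then show ?thesis using True E[OF xy(1)] sym irr by (auto simp: h_def)
    next
      case False
      then show ?thesis
        using N[OF xy False] N[OF xy(2,1) False[symmetric]] sym by (auto simp: h_def)
    qed
  qed
  have arcs: "(x, y) \<in> parcs (pK2 p) \<longleftrightarrow> x div 2 = y div 2 \<and> x \<noteq> y" if "x < 2 * p" "y < 2 * p" for x y
  proof
    assume "(x, y) \<in> parcs (pK2 p)"
    then show "x div 2 = y div 2 \<and> x \<noteq> y" by (auto simp: pK2_def)
  next
    assume xy: "x div 2 = y div 2 \<and> x \<noteq> y"
    have "x = 2 * (x div 2) + x mod 2" "y = 2 * (x div 2) + y mod 2" using xy by presburger+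
    moreover have "x mod 2 < 2" "y mod 2 < 2" by simp_all
    ultimately have "(x, y) \<in> {(2 * (x div 2), 2 * (x div 2) + 1), (2 * (x div 2) + 1, 2 * (x div 2))}"
      using xy by (auto simp: less_2_cases_iff)
    moreover have "x div 2 < p" using that by auto
    ultimately show "(x, y) \<in> parcs (pK2 p)" unfolding pK2_def by auto
  qed
  have "\<not> family_free {pK2 p, F} G"
  proof (rule not_family_free[of G "pK2 p" _ h])
    show "pair_wf_digraph G" "pair_wf_digraph (pK2 p)"
      using pair_graph_pK2 by (auto simp: pair_graph_def pair_digraph_def pair_fin_digraph_def intro: G.pair_wf_digraph)
    show "inj_on h (pverts (pK2 p))"
    proof (rule inj_onI, rule ccontr)
      fix x y assume xy: "x \<in> pverts (pK2 p)" "y \<in> pverts (pK2 p)" "h x = h y" "x \<noteq> y"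
      \<comment> \<open>This is the partner of \<open>x\<close> in its edge. If
        \<open>h x = h y\<close>, then \<open>y\<close> is also joined to it, so \<open>x\<close>
        and \<open>y\<close> lie in the same pair and are adjacent, which makes a loop at
        \<open>h x\<close>.\<close>
      define x' where "x' = (if even x then x + 1 else x - 1)"
      have x': "x' div 2 = x div 2" "x' \<noteq> x" "x' < 2 * p"
        using xy(1) by (auto simp: x'_def pK2_def elim!: oddE)
      then show False
        using adj[of x x'] adj[of y x'] adj[of x y] xy irr by (auto simp: pK2_def)
    qed
    show "h ` pverts (pK2 p) \<subseteq> pverts G" using V by (auto simp: h_def pK2_def)
    show "(h x, h y) \<in> parcs G \<longleftrightarrow> (x, y) \<in> parcs (pK2 p)"
      if "x \<in> pverts (pK2 p)" "y \<in> pverts (pK2 p)" for x y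
      using that adj arcs by (simp add: pK2_def)
  qed simp
  then show False using assms(2) by blast
qed

theorem theorem3p3:
  fixes G :: "'a pair_pre_digraph" and p :: nat
  assumes "p \<ge> 2"
    and "pair_graph G"
    and "family_free {pK2 p, gem} G"
  shows "chromatic_number G \<le> gem_bound p (clique_number G)"
proof -
  interpret G: pair_graph G by fact
  let ?E = "\<lambda>x y. (x, y) \<in> parcs G"
  interpret adjacency ?E
    by unfold_locales (use G.arcs_symmetric G.no_loops' in blast)+
  have "finite {S. clique G S}"
    by (rule finite_subset[of _ "Pow (pverts G)"]) (use G.pair_finite_verts in \<open>auto simp: clique_def\<close>)
  then have "cliques_le ?E (pverts G) (clique_number G)"
    unfolding cliques_le_def clique_number_def clique_def by (auto intro!: Max_ge)
  then have "colourable ?E (pverts G) (gem_bound p (clique_number G))"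
    by (intro gem_bound_colourable assms(1) G.pair_finite_verts gem_free_if_family_free[OF assms(2,3)]
        matching_free_if_family_free[OF assms(2,3)])
  then obtain c where c: "c ` pverts G \<subseteq> {..<gem_bound p (clique_number G)}"
    "\<forall>x\<in>pverts G. \<forall>y\<in>pverts G. ?E x y \<longrightarrow> c x \<noteq> c y"
    unfolding colourable_def by (elim exE conjE)
  then have "proper_colouring G (gem_bound p (clique_number G)) c"
    unfolding proper_colouring_def using G.in_arcsD1 G.in_arcsD2 by fast
  then show ?thesis
    unfolding chromatic_number_def by (intro Least_le) blast
qed

end
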